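(* Let $k=(k_1,k_2)$ be a root multiplicity and let $\mathcal{S}(k)$ be a non-symmetric shift operator with shift $\ell\in2\mathbb{Z}\times\mathbb{Z}$. Writing $\mathrm{Sym}(\mathcal{S}(k))=\sum_{w\in\mathbb{Z}_2}w\,\mathcal{S}(k)=\mathcal{S}(k)+s\,\mathcal{S}(k)$, we have $$\mathrm{Sym}(\mathcal{S}(k))\,D_k^2=D_{k+\ell}^2\,\mathrm{Sym}(\mathcal{S}(k)).$$ Since $\mathrm{Sym}(\mathcal{S}(k))$ restricts to an operator on $\mathbb{C}[x]$, one can apply $\beta$ to obtain $$\beta(\mathrm{Sym}(\mathcal{S}(k)))\,ML_k=ML_{k+\ell}\,\beta(\mathrm{Sym}(\mathcal{S}(k))).$$ It follows that $\beta(\mathrm{Sym}(\mathcal{S}(k)))$ is a symmetric shift operator. This can also be verified directly from the explicit expressions of the fundamental non-symmetric shift operators $\mathcal{G}_\pm(k)$, $\mathcal{E}_\pm(k)$, and the fundamental symmetric shift operators $G_\pm(k)$, $E_\pm(k)$ can be recovered from this.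
   Context: A root multiplicity for the root system $\{\pm\epsilon,\pm2\epsilon\}$ of type $BC_1$ is a complex-valued Weyl group invariant function on the roots, represented by the pair $k=(k_1,k_2)$ of its values on $\epsilon$ and $2\epsilon$. Let $s$ act on $\mathbb{C}[z^{\pm1}]$ by $s(f)(z)=f(z^{-1})$, $\mathbb{Z}_2=\langle s\rangle$, $x=(z+z^{-1})/2$ (so $\mathbb{C}[x]=\mathbb{C}[z^{\pm1}]^{\mathbb{Z}_2}$), $\rho(k)=\frac12(k_1+2k_2)$, $\mathbb{C}_\Delta[z^\pm]$ the localization of $\mathbb{C}[z^{\pm1}]$ at $\Delta=z-z^{-1}$. Let $$D_k=z\partial_z+k_1\frac{1}{1-z^{-1}}(1-s)+2k_2\frac{1}{1-z^{-2}}(1-s)-\rho(k),$$ $$ML_k=(z\partial_z)^2+k_1\frac{1+z^{-1}}{1-z^{-1}}z\partial_z+2k_2\frac{1+z^{-2}}{1-z^{-2}}z\partial_z+\rho(k)^2.$$ For a differential-reflection operator $T=\sum_w T_w w\in\mathbb{C}_\Delta[z^\pm]\otimes\mathbb{C}[z\partial_z]\otimes\mathbb{C}[\mathbb{Z}_2]$ (with $T_w$ differential operators) that restricts to an operator on $\mathbb{C}[x]$, $\beta(T)=\sum_wT_w$ is the differential operator that coincides with $T$ on $\mathbb{C}[x]$; one has $\beta(D_k^2)=ML_k$. A non-symmetric shift operator with shift $\ell$ is an element $\mathcal{S}(k)\in\mathbb{C}_\Delta[z^\pm]\otimes\mathbb{C}[z\partial_z]\otimes\mathbb{C}[\mathbb{Z}_2]$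 such that $\mathcal{S}(k)D_k=D_{k+\ell}\mathcal{S}(k)$ and $\mathcal{S}(k)$ acts on $\mathbb{C}[z^{\pm1}]$. A symmetric shift operator with shift $\ell$ is an element $S(k)\in\mathbb{C}_\Delta[z^\pm]\otimes\mathbb{C}[z\partial_z]$ such that $S(k)ML_k=ML_{k+\ell}S(k)$ and $S(k)$ acts on $\mathbb{C}[x]$. Fundamental symmetric shift operators: $G_+(k)=\frac{1}{z-z^{-1}}z\partial_z$, $G_-(k)=(z-z^{-1})z\partial_z+(k_1+2k_2-1)(z+z^{-1})+2k_1$, $E_+(k)=\frac{1+z^{-1}}{1-z^{-1}}z\partial_z+k_2-\frac12$, $E_-(k)=\frac{1-z^{-1}}{1+z^{-1}}z\partial_z+k_1+k_2-\frac12$, with shifts $(0,1),(0,-1),(2,-1),(-2,1)$. Fundamental non-symmetric shift operators, with the same respective shifts: $$\mathcal{G}_+(k)=G_+(k)-\frac{z(1-s)}{(z-z^{-1})^2},\quad\mathcal{G}_-(k)=G_-(k)+z^{-1}-zs,$$ $$\mathcal{E}_+(k)=E_+(k)-\frac{1+z^{-1}}{1-z^{-1}}\frac{1-s}{z-z^{-1}},\quad\mathcal{E}_-(k)=E_-(k)+\frac{1-z^{-1}}{1+z^{-1}}\frac{1-s}{z-z^{-1}}.$$ *)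

theory Defs
  imports
    Complex_Main
    "HOL-Computational_Algebra.Computational_Algebra"
    "HOL-Computational_Algebra.Field_as_Ring"
    "HOL-Library.Product_Plus"
begin

section \<open>Rational functions in z, the reflection s and the derivation z d/dz\<close>

type_synonym ratfun = "complex poly fract"
type_synonym oper = "ratfun \<Rightarrow> ratfun"
type_synonym root_mult = "complex \<times> complex"

definition cst :: "complex \<Rightarrow> ratfun" where
  "cst c = to_fract [:c:]"

definition Z :: ratfun where
  "Z = to_fract [:0, 1:]"

text \<open>
  Both maps are defined on the reduced fraction; \<open>theta_Fract\<close> and \<open>sact_Fract\<close> give the same formula
  for arbitrary ones. The first is the quotient rule, multiplied by \<open>z\<close>. The second is the
  substitution \<open>(s f)(z) = f(1/z)\<close>, using \<open>p(1/z) = reflect_poly p / z ^ degree p\<close>.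
\<close>

definition theta :: oper where
  "theta f = (case quot_of_fract f of (a, b) \<Rightarrow>
     Fract ([:0, 1:] * (pderiv a * b - a * pderiv b)) (b * b))"

definition sact :: oper where
  "sact f = (case quot_of_fract f of (a, b) \<Rightarrow>
     Fract (reflect_poly a * monom 1 (degree b)) (reflect_poly b * monom 1 (degree a)))"

lemma theta_Fract:
  assumes d: "d \<noteq> 0"
  shows "theta (Fract c d) = Fract ([:0, 1:] * (pderiv c * d - c * pderiv d)) (d * d)"
proof -
  obtain a b where ab: "quot_of_fract (Fract c d) = (a, b)" by fastforce
  have b: "b \<noteq> 0" using ab snd_quot_of_fract_nonzero[of "Fract c d"] by simp
  have "Fract a b = Fract c d"
    using quot_to_fract_quot_of_fract[of "Fract c d"] by (simp add: ab quot_to_fract_def)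
  hence eq: "a * d = c * b" using b d by (simp add: eq_fract)
  have "pderiv (a * d) = pderiv (c * b)" using eq by simp
  hence "pderiv a * d + a * pderiv d = pderiv c * b + c * pderiv b"
    by (simp add: pderiv_mult algebra_simps)
  with eq have "(pderiv a * b - a * pderiv b) * (d * d) = (pderiv c * d - c * pderiv d) * (b * b)"
    by algebra
  thus ?thesis using b d by (simp add: theta_def ab eq_fract)
qed

lemma sact_Fract:
  assumes d: "d \<noteq> 0"
  shows "sact (Fract c d)
    = Fract (reflect_poly c * monom 1 (degree d)) (reflect_poly d * monom 1 (degree c))"
proof -
  obtain a b where ab: "quot_of_fract (Fract c d) = (a, b)" by fastforce
  have b: "b \<noteq> 0" using ab snd_quot_of_fract_nonzero[of "Fract c d"] by simp
  have "Fract a b = Fract c d"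
    using quot_to_fract_quot_of_fract[of "Fract c d"] by (simp add: ab quot_to_fract_def)
  hence eq: "a * d = c * b" using b d by (simp add: eq_fract)
  have r: "reflect_poly a * reflect_poly d = reflect_poly c * reflect_poly b"
    using eq by (metis reflect_poly_mult)
  have "reflect_poly a * monom 1 (degree b) * (reflect_poly d * monom 1 (degree c)) =
        reflect_poly c * monom 1 (degree d) * (reflect_poly b * monom 1 (degree a))"
  proof (cases "a = 0")
    case True
    hence "c = 0" using eq b by simp
    thus ?thesis using True by simp
  next
    case False
    hence "c \<noteq> 0" using eq d by auto
    hence "degree a + degree d = degree c + degree b"
      using eq False b d by (metis degree_mult_eq)
    hence m: "monom (1::complex) (degree b) * monom 1 (degree c)
            = monom 1 (degree d) * monom 1 (degree a)"
      by (simp add: mult_monom add.commute)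
    have "reflect_poly a * monom 1 (degree b) * (reflect_poly d * monom 1 (degree c))
        = (reflect_poly a * reflect_poly d) * (monom 1 (degree b) * monom 1 (degree c))"
      by (simp only: ac_simps)
    also have "\<dots> = (reflect_poly c * reflect_poly b) * (monom 1 (degree d) * monom 1 (degree a))"
      by (simp only: r m)
    finally show ?thesis by (simp only: ac_simps)
  qed
  thus ?thesis using b d by (simp add: sact_def ab eq_fract)
qed

definition Laurent :: "ratfun set" where
  "Laurent = {to_fract p / Z ^ n | p n. True}"

definition Delta :: ratfun where
  "Delta = Z - inverse Z"

definition Laurent_Delta :: "ratfun set" where
  "Laurent_Delta = {f / Delta ^ n | f n. f \<in> Laurent}"

definition Xvar :: ratfun where
  "Xvar = (Z + inverse Z) / 2"

definition Cx :: "ratfun set" where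
  "Cx = {poly (map_poly cst p) Xvar | p. True}"


section \<open>Differential-reflection operators\<close>

text \<open>
  Elements of \<open>\<complex>\<^sub>\<Delta>[z\<^sup>\<plusminus>] \<otimes> \<complex>[z\<partial>\<^sub>z] \<otimes> \<complex>[\<int>\<^sub>2]\<close> are identified with the operators by which they
  act on the field of rational functions, so that the product is composition; the identification is
  injective by \<open>diffrefl_inj\<close> below. A polynomial over
  \<^typ>\<open>ratfun\<close> stands for its normally ordered form, the variable being replaced by \<^const>\<open>theta\<close>.
\<close>

definition diffop :: "ratfun poly \<Rightarrow> oper" where
  "diffop c f = (\<Sum>i\<le>degree c. coeff c i * (theta ^^ i) f)"

definition symbols :: "ratfun poly set" where
  "symbols = {c. \<forall>i. coeff c i \<in> Laurent_Delta}"

definition diff_ops :: "oper set" where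
  "diff_ops = diffop ` symbols"

definition diffrefl_ops :: "oper set" where
  "diffrefl_ops = {\<lambda>f. diffop a f + diffop b (sact f) | a b. a \<in> symbols \<and> b \<in> symbols}"

text \<open>
  For \<open>T = T\<^sub>1 + T\<^sub>s s\<close> this is \<open>T\<^sub>1 + T\<^sub>s\<close>; that it does not depend on the decomposition, and agrees
  with \<open>T\<close> on \<^const>\<open>Cx\<close>, is shown in \<open>beta_eq\<close> and \<open>beta_on_Cx\<close> below.
\<close>

definition beta :: "oper \<Rightarrow> oper" where
  "beta T = (THE P. \<exists>a\<in>symbols. \<exists>b\<in>symbols.
      T = (\<lambda>f. diffop a f + diffop b (sact f)) \<and> P = (\<lambda>f. diffop a f + diffop b f))"

definition Sym :: "oper \<Rightarrow> oper" where
  "Sym T = (\<lambda>f. T f + sact (T f))"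


section \<open>Shift operators\<close>

definition rho :: "root_mult \<Rightarrow> complex" where
  "rho k = (fst k + 2 * snd k) / 2"

definition Dop :: "root_mult \<Rightarrow> oper" where
  "Dop k f = theta f
     + cst (fst k) * (1 / (1 - inverse Z)) * (f - sact f)
     + 2 * cst (snd k) * (1 / (1 - inverse Z ^ 2)) * (f - sact f)
     - cst (rho k) * f"

definition MLop :: "root_mult \<Rightarrow> oper" where
  "MLop k f = theta (theta f)
     + cst (fst k) * ((1 + inverse Z) / (1 - inverse Z)) * theta f
     + 2 * cst (snd k) * ((1 + inverse Z ^ 2) / (1 - inverse Z ^ 2)) * theta f
     + cst (rho k ^ 2) * f"

definition nonsym_shift_op :: "root_mult \<Rightarrow> complex \<times> complex \<Rightarrow> oper \<Rightarrow> bool" where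
  "nonsym_shift_op k l S \<longleftrightarrow>
     S \<in> diffrefl_ops \<and> S \<circ> Dop k = Dop (k + l) \<circ> S \<and> S ` Laurent \<subseteq> Laurent"

definition sym_shift_op :: "root_mult \<Rightarrow> complex \<times> complex \<Rightarrow> oper \<Rightarrow> bool" where
  "sym_shift_op k l S \<longleftrightarrow>
     S \<in> diff_ops \<and> S \<circ> MLop k = MLop (k + l) \<circ> S \<and> S ` Cx \<subseteq> Cx"

definition shift_lattice :: "(complex \<times> complex) set" where
  "shift_lattice = {(2 * of_int m, of_int n) | (m :: int) (n :: int). True}"


section \<open>Fundamental shift operators\<close>

definition G_plus :: "root_mult \<Rightarrow> oper" where
  "G_plus k f = 1 / (Z - inverse Z) * theta f"

definition G_minus :: "root_mult \<Rightarrow> oper" where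
  "G_minus k f = (Z - inverse Z) * theta f
     + (cst (fst k + 2 * snd k - 1) * (Z + inverse Z) + cst (2 * fst k)) * f"

definition E_plus :: "root_mult \<Rightarrow> oper" where
  "E_plus k f = (1 + inverse Z) / (1 - inverse Z) * theta f + cst (snd k - 1 / 2) * f"

definition E_minus :: "root_mult \<Rightarrow> oper" where
  "E_minus k f = (1 - inverse Z) / (1 + inverse Z) * theta f + cst (fst k + snd k - 1 / 2) * f"

definition nsG_plus :: "root_mult \<Rightarrow> oper" where
  "nsG_plus k f = G_plus k f - Z * (f - sact f) / (Z - inverse Z) ^ 2"

definition nsG_minus :: "root_mult \<Rightarrow> oper" where
  "nsG_minus k f = G_minus k f + inverse Z * f - Z * sact f"

definition nsE_plus :: "root_mult \<Rightarrow> oper" where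
  "nsE_plus k f = E_plus k f
     - (1 + inverse Z) / (1 - inverse Z) * ((f - sact f) / (Z - inverse Z))"

definition nsE_minus :: "root_mult \<Rightarrow> oper" where
  "nsE_minus k f = E_minus k f
     + (1 - inverse Z) / (1 + inverse Z) * ((f - sact f) / (Z - inverse Z))"


section \<open>Well-definedness of \<open>beta\<close>\<close>

lemma Fract_eq: "Fract a b = to_fract a / to_fract b"
  by (simp add: to_fract_def)

lemma cst_0 [simp]: "cst 0 = 0"
  by (simp add: cst_def)

lemma cst_1 [simp]: "cst 1 = 1"
  by (simp add: cst_def flip: one_pCons)

lemma cst_eq_0_iff [simp]: "cst c = 0 \<longleftrightarrow> c = 0"
  by (simp add: cst_def)

lemma cst_add: "cst (a + b) = cst a + cst b"
  by (simp add: cst_def flip: to_fract_add)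

lemma cst_mult: "cst (a * b) = cst a * cst b"
  by (simp add: cst_def flip: to_fract_mult)

lemma cst_sum: "cst (sum f A) = (\<Sum>i\<in>A. cst (f i))"
  by (induction A rule: infinite_finite_induct) (auto simp: cst_add)

lemma theta_add: "theta (f + g) = theta f + theta g"
proof (cases f rule: Fract_cases, cases g rule: Fract_cases)
  fix a b c d :: "complex poly"
  assume [simp]: "f = Fract a b" "g = Fract c d" "b \<noteq> 0" "d \<noteq> 0"
  show ?thesis
    by (simp add: theta_Fract eq_fract pderiv_add pderiv_mult del: mult_pCons_left) algebra
qed

lemma theta_mult: "theta (f * g) = theta f * g + f * theta g"
proof (cases f rule: Fract_cases, cases g rule: Fract_cases)
  fix a b c d :: "complex poly"
  assume [simp]: "f = Fract a b" "g = Fract c d" "b \<noteq> 0" "d \<noteq> 0"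
  show ?thesis
    by (simp add: theta_Fract eq_fract pderiv_mult del: mult_pCons_left) algebra
qed

lemma theta_0 [simp]: "theta 0 = 0"
  using theta_add[of 0 0] by (metis add_0_right add_left_cancel)

lemma theta_1 [simp]: "theta 1 = 0"
  using theta_mult[of 1 1] by (metis add_0_right add_left_cancel mult_1 mult_1_right)

lemma theta_sum: "theta (sum f A) = (\<Sum>i\<in>A. theta (f i))"
  by (induction A rule: infinite_finite_induct) (auto simp: theta_add)

lemma theta_of_nat [simp]: "theta (of_nat n) = 0"
  by (induction n) (auto simp: theta_add)

lemma Z_nz [simp]: "Z \<noteq> 0"
  by (simp add: Z_def)

lemma theta_Z: "theta Z = Z"
  by (simp add: Z_def to_fract_def theta_Fract pderiv_pCons)

lemma theta_inverse_Z: "theta (inverse Z) = - inverse Z"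
proof -
  have "theta (Z * inverse Z) = 0" by simp
  hence "Z * (inverse Z + theta (inverse Z)) = 0"
    unfolding theta_mult theta_Z by (simp add: algebra_simps)
  thus ?thesis by (simp add: add_eq_0_iff)
qed

lemma of_nat_ratfun_eq_0: "(of_nat n :: ratfun) = 0 \<longleftrightarrow> n = 0"
  by (simp add: of_nat_fract Zero_fract_def eq_fract)

lemma two_nz: "(2 :: ratfun) \<noteq> 0"
  using of_nat_ratfun_eq_0[of 2] by simp

lemma theta_half: "theta (f / 2) = theta f / 2"
proof -
  have "theta f = theta (of_nat 2 * (f / 2))" using two_nz by simp
  also have "\<dots> = 2 * theta (f / 2)" unfolding theta_mult theta_of_nat by simp
  finally show ?thesis using two_nz by (simp add: field_simps)
qed

lemma theta_Xvar_nz: "theta Xvar \<noteq> 0"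
proof
  assume "theta Xvar = 0"
  hence "Z = inverse Z"
    using two_nz by (simp add: Xvar_def theta_half theta_add theta_Z theta_inverse_Z)
  hence "Z * Z = 1" by (metis Z_nz right_inverse)
  thus False by (simp add: Z_def flip: to_fract_mult to_fract_1) (simp add: one_pCons)
qed

lemma theta_pow_mult:
  "\<exists>d. \<forall>f. (theta ^^ Suc n) (x * f) = x * (theta ^^ Suc n) f
     + of_nat (Suc n) * theta x * (theta ^^ n) f + (\<Sum>j<n. d j * (theta ^^ j) f)"
proof (induction n)
  case 0
  show ?case by (simp add: theta_mult)
next
  case (Suc n)
  then obtain d where d: "\<And>f. (theta ^^ Suc n) (x * f) = x * (theta ^^ Suc n) f
     + of_nat (Suc n) * theta x * (theta ^^ n) f + (\<Sum>j<n. d j * (theta ^^ j) f)"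
    by blast
  define e where "e = (\<lambda>j. (if j < n then theta (d j) else of_nat (Suc n) * theta (theta x))
     + (if j = 0 then 0 else d (j - 1)))"
  have "(theta ^^ Suc (Suc n)) (x * f) = x * (theta ^^ Suc (Suc n)) f
     + of_nat (Suc (Suc n)) * theta x * (theta ^^ Suc n) f + (\<Sum>j<Suc n. e j * (theta ^^ j) f)"
    for f
  proof -
    have "(\<Sum>j<Suc n. e j * (theta ^^ j) f)
        = (\<Sum>j<Suc n. (if j < n then theta (d j) else of_nat (Suc n) * theta (theta x))
              * (theta ^^ j) f)
          + (\<Sum>j<Suc n. (if j = 0 then 0 else d (j - 1)) * (theta ^^ j) f)"
      by (simp only: e_def distrib_right sum.distrib)
    also have "(\<Sum>j<Suc n. (if j < n then theta (d j) else of_nat (Suc n) * theta (theta x))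
              * (theta ^^ j) f)
        = (\<Sum>j<n. theta (d j) * (theta ^^ j) f)
          + of_nat (Suc n) * theta (theta x) * (theta ^^ n) f"
      by simp
    also have "(\<Sum>j<Suc n. (if j = 0 then 0 else d (j - 1)) * (theta ^^ j) f)
        = (\<Sum>j<n. d j * theta ((theta ^^ j) f))"
      by (subst sum.lessThan_Suc_shift) simp
    finally have e: "(\<Sum>j<Suc n. e j * (theta ^^ j) f)
      = (\<Sum>j<n. theta (d j) * (theta ^^ j) f)
          + of_nat (Suc n) * theta (theta x) * (theta ^^ n) f
          + (\<Sum>j<n. d j * theta ((theta ^^ j) f))" .
    have "(theta ^^ Suc (Suc n)) (x * f) = theta ((theta ^^ Suc n) (x * f))" by simp
    also have "\<dots> = theta x * (theta ^^ Suc n) f + x * (theta ^^ Suc (Suc n)) f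
        + (of_nat (Suc n) * theta (theta x) * (theta ^^ n) f
           + of_nat (Suc n) * theta x * (theta ^^ Suc n) f)
        + ((\<Sum>j<n. theta (d j) * (theta ^^ j) f) + (\<Sum>j<n. d j * theta ((theta ^^ j) f)))"
      unfolding d theta_add theta_mult theta_sum theta_of_nat sum.distrib by simp
    finally show ?thesis unfolding e by (simp add: algebra_simps)
  qed
  thus ?case by blast
qed

lemma Cx_1: "1 \<in> Cx"
  unfolding Cx_def by (rule CollectI, rule exI[of _ 1]) (simp add: one_pCons map_poly_pCons)

lemma Cx_mult: "f \<in> Cx \<Longrightarrow> Xvar * f \<in> Cx"
proof -
  assume "f \<in> Cx"
  then obtain p where "f = poly (map_poly cst p) Xvar" by (auto simp: Cx_def)
  hence "Xvar * f = poly (map_poly cst (pCons 0 p)) Xvar"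
    by (simp add: map_poly_pCons)
  thus ?thesis unfolding Cx_def by blast
qed

lemma vanish_Cx:
  assumes "\<And>f. f \<in> Cx \<Longrightarrow> (\<Sum>i<n. c i * (theta ^^ i) f) = 0"
  shows "\<forall>i<n. c i = 0"
  using assms
proof (induction n arbitrary: c)
  case 0
  show ?case by simp
next
  case (Suc n)
  have "c n = 0"
  proof (cases n)
    case 0
    with Suc.prems[OF Cx_1] show ?thesis by simp
  next
    case (Suc m)
    have "\<forall>i. \<exists>d. \<forall>f. (theta ^^ Suc i) (Xvar * f) = Xvar * (theta ^^ Suc i) f
       + of_nat (Suc i) * theta Xvar * (theta ^^ i) f + (\<Sum>j<i. d j * (theta ^^ j) f)"
      by (rule allI) (rule theta_pow_mult)
    from choice[OF this] obtain d where d: "\<And>i f. (theta ^^ Suc i) (Xvar * f)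
       = Xvar * (theta ^^ Suc i) f
         + of_nat (Suc i) * theta Xvar * (theta ^^ i) f + (\<Sum>j<i. d i j * (theta ^^ j) f)"
      by (elim exE) (rule that, elim allE, assumption)
    define e where "e = (\<lambda>j. c (Suc j) * (of_nat (Suc j) * theta Xvar)
        + (\<Sum>i<n. if j < i then c (Suc i) * d i j else 0))"
    have "\<forall>j<n. e j = 0"
    proof (rule Suc.IH)
      fix f assume f: "f \<in> Cx"
      have inner: "(\<Sum>j<i. d i j * (theta ^^ j) f)
          = (\<Sum>j<n. if j < i then d i j * (theta ^^ j) f else 0)" if "i < n" for i
        using that by (intro sum.mono_neutral_cong_left) auto
      have "0 = (\<Sum>i<Suc n. c i * (theta ^^ i) (Xvar * f))
          - Xvar * (\<Sum>i<Suc n. c i * (theta ^^ i) f)"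
        using Suc.prems[OF f] Suc.prems[OF Cx_mult[OF f]] by simp
      also have "\<dots> = (\<Sum>i<Suc n. c i * ((theta ^^ i) (Xvar * f) - Xvar * (theta ^^ i) f))"
        by (simp only: sum_distrib_left right_diff_distrib sum_subtractf mult.left_commute)
      also have "\<dots> = (\<Sum>i<n. c (Suc i)
          * ((theta ^^ Suc i) (Xvar * f) - Xvar * (theta ^^ Suc i) f))"
        by (subst sum.lessThan_Suc_shift) simp
      also have "\<dots> = (\<Sum>i<n. c (Suc i) * (of_nat (Suc i) * theta Xvar) * (theta ^^ i) f
          + (\<Sum>j<n. (if j < i then c (Suc i) * d i j else 0) * (theta ^^ j) f))"
      proof (rule sum.cong, simp)
        fix i assume "i \<in> {..<n}"
        hence i: "i < n" by simp
        have "(theta ^^ Suc i) (Xvar * f) - Xvar * (theta ^^ Suc i) f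
            = of_nat (Suc i) * theta Xvar * (theta ^^ i) f
              + (\<Sum>j<n. if j < i then d i j * (theta ^^ j) f else 0)"
          unfolding d inner[OF i] by (simp del: funpow.simps)
        moreover have "(\<Sum>j<n. (if j < i then c (Suc i) * d i j else 0) * (theta ^^ j) f)
            = c (Suc i) * (\<Sum>j<n. if j < i then d i j * (theta ^^ j) f else 0)"
          unfolding sum_distrib_left by (rule sum.cong) auto
        ultimately show "c (Suc i) * ((theta ^^ Suc i) (Xvar * f) - Xvar * (theta ^^ Suc i) f)
            = c (Suc i) * (of_nat (Suc i) * theta Xvar) * (theta ^^ i) f
              + (\<Sum>j<n. (if j < i then c (Suc i) * d i j else 0) * (theta ^^ j) f)"
          by (simp only: distrib_left mult.assoc)
      qed
      also have "\<dots> = (\<Sum>i<n. c (Suc i) * (of_nat (Suc i) * theta Xvar) * (theta ^^ i) f)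
          + (\<Sum>j<n. \<Sum>i<n. (if j < i then c (Suc i) * d i j else 0) * (theta ^^ j) f)"
        by (simp only: sum.distrib) (subst (2) sum.swap, rule refl)
      also have "\<dots> = (\<Sum>j<n. e j * (theta ^^ j) f)"
        by (simp only: e_def distrib_right sum_distrib_right sum.distrib)
      finally show "(\<Sum>j<n. e j * (theta ^^ j) f) = 0" by simp
    qed
    hence "e m = 0" using Suc by simp
    moreover have "(\<Sum>i<n. if m < i then c (Suc i) * d i m else 0) = 0"
      using Suc by (intro sum.neutral) auto
    ultimately have "c n * (of_nat n * theta Xvar) = 0"
      by (simp only: e_def Suc add_0_right)
    thus ?thesis using theta_Xvar_nz Suc of_nat_ratfun_eq_0[of n] by auto
  qed
  moreover have "\<forall>i<n. c i = 0"
  proof (rule Suc.IH)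
    fix f assume "f \<in> Cx"
    from Suc.prems[OF this] \<open>c n = 0\<close> show "(\<Sum>i<n. c i * (theta ^^ i) f) = 0" by simp
  qed
  ultimately show ?case by (auto simp: less_Suc_eq)
qed

lemma diffop_lessThan:
  assumes "degree c < n"
  shows "diffop c f = (\<Sum>i<n. coeff c i * (theta ^^ i) f)"
  unfolding diffop_def using assms
  by (intro sum.mono_neutral_left) (auto simp: coeff_eq_0)

lemma diffop_add: "diffop (a + b) f = diffop a f + diffop b f"
proof -
  define n where "n = Suc (max (degree a) (degree b))"
  have "degree a < n" "degree b < n" "degree (a + b) < n"
    unfolding n_def by (auto simp: less_Suc_eq_le degree_add_le)
  thus ?thesis
    by (simp add: diffop_lessThan[where n = n] sum.distrib distrib_right)
qed

lemma diffop_inj_Cx: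
  assumes "\<And>f. f \<in> Cx \<Longrightarrow> diffop a f = diffop b f"
  shows "a = b"
proof -
  define n where "n = Suc (max (degree a) (degree b))"
  have n: "degree a < n" "degree b < n" unfolding n_def by auto
  have "\<forall>i<n. coeff a i - coeff b i = 0"
  proof (rule vanish_Cx)
    fix f assume "f \<in> Cx"
    from assms[OF this] show "(\<Sum>i<n. (coeff a i - coeff b i) * (theta ^^ i) f) = 0"
      using n by (simp add: diffop_lessThan[where n = n] left_diff_distrib sum_subtractf)
  qed
  moreover have "coeff a i - coeff b i = 0" if "i \<ge> n" for i
    using that n by (simp add: coeff_eq_0)
  ultimately have "coeff a i = coeff b i" for i
    by (metis eq_iff_diff_eq_0 not_le)
  thus ?thesis by (simp add: poly_eq_iff)
qed

lemma poly_Z: "poly (map_poly cst p) Z = to_fract p"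
  by (induction p)
     (auto simp: map_poly_pCons cst_def Z_def simp flip: to_fract_add to_fract_mult)

lemma reflect_cst: "reflect_poly (map_poly cst p) = map_poly cst (reflect_poly p)"
proof -
  have "degree (map_poly cst p) = degree p" by (rule degree_map_poly) auto
  thus ?thesis by (auto simp: poly_eq_iff coeff_reflect_poly coeff_map_poly cst_def)
qed

lemma to_fract_reflect_poly:
  "to_fract (reflect_poly p) = Z ^ degree p * poly (map_poly cst p) (inverse Z)"
proof -
  have "degree (map_poly cst p) = degree p" by (rule degree_map_poly) auto
  thus ?thesis
    using poly_reflect_poly_nz[of Z "map_poly cst p"] by (simp add: reflect_cst poly_Z)
qed

lemma to_fract_monom: "to_fract (monom 1 n) = Z ^ n"
proof (induction n)
  case (Suc n)
  have "monom (1 :: complex) (Suc n) = [:0, 1:] * monom 1 n" by (simp add: monom_Suc smult_monom)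
  thus ?case by (simp only: to_fract_mult Suc Z_def[symmetric] power_Suc)
qed (simp flip: one_pCons add: monom_0)

lemma sact_Fract':
  assumes "b \<noteq> 0"
  shows "sact (Fract a b)
    = poly (map_poly cst a) (inverse Z) / poly (map_poly cst b) (inverse Z)"
  unfolding sact_Fract[OF assms] unfolding Fract_eq to_fract_mult to_fract_reflect_poly to_fract_monom
  by simp

lemma poly_cst_inverse_Z_nz: "b \<noteq> 0 \<Longrightarrow> poly (map_poly cst b) (inverse Z) \<noteq> 0"
  using to_fract_reflect_poly[of b] by auto

lemma map_poly_cst_add: "map_poly cst (p + q) = map_poly cst p + map_poly cst q"
  by (auto simp: poly_eq_iff coeff_map_poly cst_add)

lemma map_poly_cst_mult: "map_poly cst (p * q) = map_poly cst p * map_poly cst q"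
  by (auto simp: poly_eq_iff coeff_map_poly coeff_mult cst_sum cst_mult)

lemma sact_add: "sact (f + g) = sact f + sact g"
proof (cases f rule: Fract_cases, cases g rule: Fract_cases)
  fix a b c d :: "complex poly"
  assume [simp]: "f = Fract a b" "g = Fract c d" "b \<noteq> 0" "d \<noteq> 0"
  show ?thesis
    using poly_cst_inverse_Z_nz[of b] poly_cst_inverse_Z_nz[of d]
    by (simp add: sact_Fract' map_poly_cst_add map_poly_cst_mult field_simps)
qed

lemma sact_mult: "sact (f * g) = sact f * sact g"
proof (cases f rule: Fract_cases, cases g rule: Fract_cases)
  fix a b c d :: "complex poly"
  assume [simp]: "f = Fract a b" "g = Fract c d" "b \<noteq> 0" "d \<noteq> 0"
  show ?thesis by (simp add: sact_Fract' map_poly_cst_mult)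
qed

lemma sact_cst [simp]: "sact (cst c) = cst c"
  by (simp add: cst_def to_fract_def sact_Fract)

lemma sact_Z: "sact Z = inverse Z"
proof -
  have "sact Z = sact (Fract [:0, 1:] 1)" by (simp add: Z_def to_fract_def)
  also have "\<dots> = inverse Z" by (subst sact_Fract') (simp_all add: one_pCons map_poly_pCons)
  finally show ?thesis .
qed

lemma sact_0 [simp]: "sact 0 = 0" and sact_1 [simp]: "sact 1 = 1"
  using sact_cst[of 0] sact_cst[of 1] by simp_all

lemma sact_inverse_Z: "sact (inverse Z) = Z"
  using sact_mult[of Z "inverse Z"] by (simp add: sact_Z field_simps)

lemma sact_Xvar: "sact Xvar = Xvar"
proof -
  have 2: "cst 2 = 2"
    using cst_add[of 1 1] by simp
  have X: "Xvar = cst (1 / 2) * (Z + inverse Z)"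
    using cst_mult[of 2 "1 / 2"] two_nz by (simp add: Xvar_def 2 field_simps)
  show ?thesis
    unfolding X sact_mult sact_add sact_cst sact_Z sact_inverse_Z by (simp only: add.commute)
qed

lemma sact_Cx: "f \<in> Cx \<Longrightarrow> sact f = f"
proof -
  have "sact (poly (map_poly cst p) Xvar) = poly (map_poly cst p) Xvar" for p
    by (induction p) (auto simp: map_poly_pCons sact_add sact_mult sact_Xvar)
  thus "f \<in> Cx \<Longrightarrow> sact f = f" by (auto simp: Cx_def)
qed

lemma theta_pow_mult':
  "\<exists>d. \<forall>f. (theta ^^ n) (x * f) = x * (theta ^^ n) f + (\<Sum>j<n. d j * (theta ^^ j) f)"
proof (cases n)
  case 0
  thus ?thesis by simp
next
  case (Suc m)
  obtain d where d: "\<forall>f. (theta ^^ Suc m) (x * f) = x * (theta ^^ Suc m) f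
     + of_nat (Suc m) * theta x * (theta ^^ m) f + (\<Sum>j<m. d j * (theta ^^ j) f)"
    using theta_pow_mult[of m x] by (elim exE) (rule that)
  define e where "e = d(m := of_nat (Suc m) * theta x)"
  have "(\<Sum>j<Suc m. e j * (theta ^^ j) f)
      = (\<Sum>j<m. d j * (theta ^^ j) f) + of_nat (Suc m) * theta x * (theta ^^ m) f" for f
    by (simp add: e_def)
  hence "\<forall>f. (theta ^^ n) (x * f) = x * (theta ^^ n) f + (\<Sum>j<n. e j * (theta ^^ j) f)"
    unfolding Suc d[rule_format] by (simp only: ac_simps) simp
  thus ?thesis by (intro exI[of _ e])
qed

lemma Delta_nz: "Delta \<noteq> 0"
  using theta_Xvar_nz two_nz
  by (simp add: Delta_def Xvar_def theta_half theta_add theta_Z theta_inverse_Z)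

lemma vanish_Delta_Cx:
  assumes "\<And>f. f \<in> Cx \<Longrightarrow> (\<Sum>i<n. c i * (theta ^^ i) (Delta * f)) = 0"
  shows "\<forall>i<n. c i = 0"
  using assms
proof (induction n)
  case 0
  show ?case by simp
next
  case (Suc n)
  have "\<forall>i. \<exists>d. \<forall>f. (theta ^^ i) (Delta * f)
      = Delta * (theta ^^ i) f + (\<Sum>j<i. d j * (theta ^^ j) f)"
    by (rule allI) (rule theta_pow_mult')
  from choice[OF this] obtain d where d: "\<And>i f. (theta ^^ i) (Delta * f)
      = Delta * (theta ^^ i) f + (\<Sum>j<i. d i j * (theta ^^ j) f)"
    by (elim exE) (rule that, elim allE, assumption)
  define e where "e = (\<lambda>j. c j * Delta
      + (\<Sum>i<Suc n. if j < i then c i * d i j else 0))"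
  have "\<forall>j<Suc n. e j = 0"
  proof (rule vanish_Cx)
    fix f assume f: "f \<in> Cx"
    have inner: "c i * (\<Sum>j<i. d i j * (theta ^^ j) f)
        = (\<Sum>j<Suc n. (if j < i then c i * d i j else 0) * (theta ^^ j) f)" if "i < Suc n" for i
      unfolding sum_distrib_left using that
      by (intro sum.mono_neutral_cong_left) (auto simp: mult.assoc)
    have "0 = (\<Sum>i<Suc n. c i * (theta ^^ i) (Delta * f))"
      using Suc.prems[OF f] by simp
    also have "\<dots> = (\<Sum>i<Suc n. c i * Delta * (theta ^^ i) f
        + (\<Sum>j<Suc n. (if j < i then c i * d i j else 0) * (theta ^^ j) f))"
      by (rule sum.cong) (simp_all only: d distrib_left inner lessThan_iff mult.assoc)
    also have "\<dots> = (\<Sum>i<Suc n. c i * Delta * (theta ^^ i) f)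
        + (\<Sum>j<Suc n. \<Sum>i<Suc n. (if j < i then c i * d i j else 0) * (theta ^^ j) f)"
      by (simp only: sum.distrib) (subst (2) sum.swap, rule refl)
    also have "\<dots> = (\<Sum>j<Suc n. e j * (theta ^^ j) f)"
      by (simp only: e_def distrib_right sum_distrib_right sum.distrib)
    finally show "(\<Sum>j<Suc n. e j * (theta ^^ j) f) = 0" by simp
  qed
  hence "e n = 0" by simp
  moreover have "(\<Sum>i<Suc n. if n < i then c i * d i n else 0) = 0"
    by (intro sum.neutral) auto
  ultimately have "c n * Delta = 0" by (simp only: e_def add_0_right)
  hence "c n = 0" using Delta_nz by simp
  moreover have "\<forall>i<n. c i = 0"
  proof (rule Suc.IH)
    fix f assume "f \<in> Cx"
    from Suc.prems[OF this] \<open>c n = 0\<close>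
    show "(\<Sum>i<n. c i * (theta ^^ i) (Delta * f)) = 0" by simp
  qed
  ultimately show ?case by (auto simp: less_Suc_eq)
qed

lemma sact_uminus: "sact (- f) = - sact f"
  using sact_add[of f "- f"] by (simp add: eq_neg_iff_add_eq_0 add.commute)

lemma sact_Delta: "sact Delta = - Delta"
  by (simp add: Delta_def diff_conv_add_uminus sact_add sact_uminus sact_Z sact_inverse_Z
           del: add_uminus_conv_diff)

lemma theta_pow_uminus: "(theta ^^ n) (- f) = - (theta ^^ n) f"
proof (induction n)
  case (Suc n)
  have "theta (- g) = - theta g" for g
    using theta_add[of g "- g"] by (simp add: eq_neg_iff_add_eq_0 add.commute)
  thus ?case by (simp add: Suc)
qed simp

lemma diffop_uminus: "diffop c (- f) = - diffop c f"
  by (simp add: diffop_def theta_pow_uminus sum_negf)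

lemma diffrefl_inj:
  assumes "(\<lambda>f. diffop a f + diffop b (sact f)) = (\<lambda>f. diffop a' f + diffop b' (sact f))"
  shows "a = a' \<and> b = b'"
proof -
  note eq = fun_cong[OF assms]
  define n where "n = Suc (Max {degree a, degree a', degree b, degree b'})"
  have n: "degree a < n" "degree a' < n" "degree b < n" "degree b' < n"
    unfolding n_def by (auto simp: less_Suc_eq_le)
  have sum: "a + b = a' + b'"
  proof (rule diffop_inj_Cx)
    fix f assume "f \<in> Cx"
    with eq[of f] show "diffop (a + b) f = diffop (a' + b') f"
      by (simp add: diffop_add sact_Cx)
  qed
  have "\<forall>i<n. (coeff a i - coeff b i) - (coeff a' i - coeff b' i) = 0"
  proof (rule vanish_Delta_Cx)
    fix f assume "f \<in> Cx"
    with eq[of "Delta * f"]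
    have "diffop a (Delta * f) - diffop b (Delta * f)
        = diffop a' (Delta * f) - diffop b' (Delta * f)"
      by (simp add: sact_mult sact_Delta sact_Cx diffop_uminus)
    thus "(\<Sum>i<n. ((coeff a i - coeff b i) - (coeff a' i - coeff b' i))
        * (theta ^^ i) (Delta * f)) = 0"
      using n by (simp add: diffop_lessThan[where n = n] left_diff_distrib sum_subtractf)
  qed
  moreover have "(coeff a i - coeff b i) - (coeff a' i - coeff b' i) = 0" if "i \<ge> n" for i
    using that n by (simp add: coeff_eq_0)
  ultimately have "a - b = a' - b'"
    by (metis coeff_diff eq_iff_diff_eq_0 not_le poly_eqI)
  hence "(a + b) + (a - b) = (a' + b') + (a' - b')" using sum by simp
  hence aa: "a + a = a' + a'" by simp
  have "coeff a i = coeff a' i" for i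
  proof -
    have "2 * coeff a i = 2 * coeff a' i"
      using arg_cong[OF aa, of "\<lambda>p. coeff p i"] by (simp only: coeff_add mult_2)
    thus ?thesis using two_nz by simp
  qed
  hence "a = a'" by (rule poly_eqI)
  thus ?thesis using sum by simp
qed

lemma beta_eq:
  assumes a: "a \<in> symbols" and b: "b \<in> symbols"
    and T: "T = (\<lambda>f. diffop a f + diffop b (sact f))"
  shows "beta T = (\<lambda>f. diffop a f + diffop b f)"
  unfolding beta_def
proof (rule the_equality)
  show "\<exists>a'\<in>symbols. \<exists>b'\<in>symbols. T = (\<lambda>f. diffop a' f + diffop b' (sact f))
      \<and> (\<lambda>f. diffop a f + diffop b f) = (\<lambda>f. diffop a' f + diffop b' f)"
    using assms by blast
next
  fix P
  assume "\<exists>a\<in>symbols. \<exists>b\<in>symbols. T = (\<lambda>f. diffop a f + diffop b (sact f))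
      \<and> P = (\<lambda>f. diffop a f + diffop b f)"
  then obtain a' b' where T': "T = (\<lambda>f. diffop a' f + diffop b' (sact f))"
    and P: "P = (\<lambda>f. diffop a' f + diffop b' f)" by blast
  have "a' + b' = a + b"
  proof (rule diffop_inj_Cx)
    fix f assume "f \<in> Cx"
    with fun_cong[OF T', of f] fun_cong[OF T, of f]
    show "diffop (a' + b') f = diffop (a + b) f" by (simp add: diffop_add sact_Cx)
  qed
  thus "P = (\<lambda>f. diffop a f + diffop b f)"
    by (simp add: P flip: diffop_add)
qed

lemma beta_on_Cx:
  assumes "T \<in> diffrefl_ops" "f \<in> Cx"
  shows "beta T f = T f"
proof -
  obtain a b where "a \<in> symbols" "b \<in> symbols" "T = (\<lambda>f. diffop a f + diffop b (sact f))"
    using assms(1) by (auto simp: diffrefl_ops_def)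
  thus ?thesis using beta_eq[of a b T] sact_Cx[OF assms(2)] by simp
qed

end

theory Submission
  imports Defs
begin

text \<open>
  The rank one graded Hecke relation \<open>s D\<^sub>k + D\<^sub>k s = -2 \<rho>(k)\<close> (\<open>sact_Dop\<close>) makes \<open>D\<^sub>k\<^sup>2\<close> commute with
  the reflection (\<open>sact_Dop_Dop\<close>). Multiplying \<open>S D\<^sub>k\<^sup>2 = D\<^sub>k\<^sub>+\<^sub>l\<^sup>2 S\<close> on the left by \<open>1 + s\<close> therefore
  gives the intertwining relation for \<open>Sym S\<close>. On invariant functions \<open>D\<^sub>k\<^sup>2\<close> is \<open>ML\<^sub>k\<close>
  (\<open>MLop_on_invariants\<close>) and \<open>Sym S\<close> is \<open>beta (Sym S)\<close>, so the relation for \<open>beta (Sym S)\<close> and \<open>ML\<close>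
  holds on \<open>\<complex>[x]\<close>; it holds everywhere because compositions of differential operators are
  differential operators (\<open>diffop_comp\<close>) and these are determined by their values on \<open>\<complex>[x]\<close>. That
  \<open>Sym S\<close> preserves \<open>\<complex>[x]\<close> amounts to \<open>f + s f\<close> being a polynomial in \<open>x\<close> for every Laurent
  polynomial \<open>f\<close> (\<open>symmetrization_Cx\<close>).

  The four fundamental operators have the form \<open>T = c \<theta> + d + e s\<close>, with \<open>\<theta> = z\<partial>\<^sub>z\<close> and \<open>s c = -c\<close>.
  Comparing the coefficients of \<open>\<theta>\<close>, \<open>\<theta> s\<close>, \<open>1\<close> and \<open>s\<close> turns \<open>T D\<^sub>k = D\<^sub>k\<^sub>+\<^sub>l T\<close> into four identities
  between rational functions (\<open>first_order_Dop\<close>). Each is an identity of polynomials in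
  \<open>z\<close>, \<open>z\<^sup>-\<^sup>1\<close>, \<open>(z - 1)\<^sup>-\<^sup>1\<close>, \<open>(z + 1)\<^sup>-\<^sup>1\<close> modulo the obvious relations, and is settled by Groebner bases.
  The poles of \<open>T\<close> cancel on Laurent polynomials because \<open>T x - x T\<close> is multiplication by
  \<open>c (z - z\<^sup>-\<^sup>1) / 2\<close>: once that factor is a Laurent polynomial it is enough to look at \<open>T 1\<close> and
  \<open>T z\<close>, since \<open>1\<close> and \<open>z\<close> generate \<open>\<complex>[z\<^sup>\<plusminus>]\<close> over \<open>\<complex>[x]\<close> (\<open>first_order_Laurent\<close>).
\<close>

section \<open>The derivation and the reflection\<close>

lemma cst_uminus: "cst (- a) = - cst a"
  using cst_add[of a "- a"] by (simp add: eq_neg_iff_add_eq_0 add.commute)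

lemma cst_diff: "cst (a - b) = cst a - cst b"
  using cst_add[of a "- b"] by (simp add: cst_uminus)

lemma cst_of_nat [simp]: "cst (of_nat n) = of_nat n"
  by (induction n) (simp_all add: cst_add)

lemma cst_numeral [simp]: "cst (numeral n) = numeral n"
  using cst_of_nat[of "numeral n"] by simp

lemma cst_half: "cst (a / 2) = cst a / 2"
  using cst_mult[of "a / 2" 2] two_nz by (simp add: field_simps)

lemma theta_cst [simp]: "theta (cst c) = 0"
  by (simp add: cst_def to_fract_def theta_Fract pderiv_pCons eq_fract flip: Zero_fract_def)

lemma theta_numeral [simp]: "theta (numeral n) = 0"
  using theta_of_nat[of "numeral n"] by simp

lemma sact_numeral [simp]: "sact (numeral n) = numeral n"
  using sact_cst[of "numeral n"] by simp

lemma theta_uminus: "theta (- f) = - theta f"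
  using theta_pow_uminus[of 1 f] by simp

lemma theta_diff: "theta (f - g) = theta f - theta g"
  using theta_add[of f "- g"] by (simp add: theta_uminus)

lemma sact_diff: "sact (f - g) = sact f - sact g"
  using sact_add[of f "- g"] by (simp add: sact_uminus)

lemma theta_inverse: "theta (inverse f) = - (theta f * inverse f ^ 2)"
proof (cases "f = 0")
  case False
  have "theta (f * inverse f) = 0" using False by simp
  hence "inverse f * (theta f * inverse f + f * theta (inverse f)) = 0"
    unfolding theta_mult by simp
  moreover have "inverse f * (theta f * inverse f + f * theta (inverse f))
      = theta f * inverse f ^ 2 + theta (inverse f)"
    using False by (simp add: field_simps power2_eq_square)
  ultimately have "theta f * inverse f ^ 2 + theta (inverse f) = 0" by metis
  thus ?thesis by (simp add: eq_neg_iff_add_eq_0 add.commute)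
qed simp

lemma sact_inverse: "sact (inverse f) = inverse (sact f)"
proof (cases "f = 0")
  case False
  have "sact f * sact (inverse f) = 1" using False by (simp flip: sact_mult)
  thus ?thesis by (metis inverse_unique)
qed simp

lemma theta_divide: "theta (f / g) = theta f / g - f * theta g / g ^ 2"
  by (simp add: divide_inverse theta_mult theta_inverse power_inverse)

lemma sact_divide: "sact (f / g) = sact f / sact g"
  by (simp add: divide_inverse sact_mult sact_inverse)

lemma theta_power2: "theta (f ^ 2) = 2 * f * theta f"
  by (simp add: power2_eq_square theta_mult algebra_simps)

lemma sact_power: "sact (f ^ n) = sact f ^ n"
  by (induction n) (simp_all add: sact_mult)

lemma to_fract_pCons: "to_fract (pCons c p) = cst c + Z * to_fract p"
  by (simp add: cst_def Z_def flip: to_fract_add to_fract_mult)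

text \<open>
  The substitution \<open>z \<mapsto> 1/z\<close> reverses the vector field \<open>z\<partial>\<^sub>z\<close>. The sign is checked on the generator
  \<open>z\<close> and propagates through products and quotients.
\<close>

lemma sact_theta: "sact (theta f) = - theta (sact f)"
proof -
  have poly: "sact (theta (to_fract p)) = - theta (sact (to_fract p))" for p
    by (induction p)
      (simp_all add: to_fract_pCons theta_add theta_mult theta_Z sact_add sact_mult sact_Z
        theta_inverse_Z algebra_simps)
  show ?thesis
  proof (cases f rule: Fract_cases)
    case (Fract a b)
    thus ?thesis
      by (simp add: Fract_eq theta_divide sact_divide sact_diff sact_mult sact_power poly)
  qed
qed

lemma sact_sact [simp]: "sact (sact f) = f"
proof -
  have poly: "sact (sact (to_fract p)) = to_fract p" for p
    by (induction p) (simp_all add: to_fract_pCons sact_add sact_mult sact_Z sact_inverse_Z)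
  show ?thesis
    by (cases f rule: Fract_cases) (simp add: Fract_eq sact_divide poly)
qed

lemma theta_sact: "theta (sact f) = - sact (theta f)"
  by (simp add: sact_theta)

lemma theta_Xvar: "theta Xvar = Delta / 2"
  by (simp add: Xvar_def Delta_def theta_half theta_add theta_Z theta_inverse_Z)

lemma two_Xvar: "2 * Xvar = Z + inverse Z"
  using two_nz by (simp add: Xvar_def)

lemma Z_neq_1: "Z \<noteq> 1" and Z_neq_m1: "Z + 1 \<noteq> 0" and Z2_neq_1: "Z ^ 2 \<noteq> 1"
proof -
  show *: "Z ^ 2 \<noteq> 1"
    using Delta_nz by (auto simp: Delta_def field_simps power2_eq_square)
  show "Z \<noteq> 1" using * by auto
  show "Z + 1 \<noteq> 0" using * by (metis add_eq_0_iff2 power2_minus power_one)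
qed


section \<open>Laurent polynomials as a module over the invariants\<close>

lemma LaurentI: "to_fract p / Z ^ n \<in> Laurent"
  unfolding Laurent_def by blast

lemma Laurent_add: "f \<in> Laurent \<Longrightarrow> g \<in> Laurent \<Longrightarrow> f + g \<in> Laurent"
proof -
  assume "f \<in> Laurent" "g \<in> Laurent"
  then obtain p n q m where fg: "f = to_fract p / Z ^ n" "g = to_fract q / Z ^ m"
    unfolding Laurent_def by blast
  have "f + g = to_fract (p * monom 1 m + q * monom 1 n) / Z ^ (n + m)"
    by (simp add: fg to_fract_monom to_fract_add to_fract_mult field_simps power_add)
  thus ?thesis using LaurentI by metis
qed

lemma Laurent_mult: "f \<in> Laurent \<Longrightarrow> g \<in> Laurent \<Longrightarrow> f * g \<in> Laurent"
proof -
  assume "f \<in> Laurent" "g \<in> Laurent"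
  then obtain p n q m where fg: "f = to_fract p / Z ^ n" "g = to_fract q / Z ^ m"
    unfolding Laurent_def by blast
  have "f * g = to_fract (p * q) / Z ^ (n + m)"
    by (simp add: fg to_fract_mult power_add)
  thus ?thesis using LaurentI by metis
qed

lemma Laurent_cst [simp]: "cst c \<in> Laurent"
  using LaurentI[of "[:c:]" 0] by (simp add: cst_def)

lemma Laurent_numeral [simp]: "numeral n \<in> Laurent"
  using Laurent_cst[of "numeral n"] by simp

lemma Laurent_0 [simp]: "0 \<in> Laurent" and Laurent_1 [simp]: "1 \<in> Laurent"
  using Laurent_cst[of 0] Laurent_cst[of 1] by simp_all

lemma Laurent_uminus: "f \<in> Laurent \<Longrightarrow> - f \<in> Laurent"
  using Laurent_mult[OF Laurent_cst[of "- 1"], of f] by (simp add: cst_uminus)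

lemma Laurent_diff: "f \<in> Laurent \<Longrightarrow> g \<in> Laurent \<Longrightarrow> f - g \<in> Laurent"
  using Laurent_add[of f "- g"] Laurent_uminus by simp

lemma Laurent_Z [simp]: "Z \<in> Laurent"
  using LaurentI[of "[:0, 1:]" 0] by (simp add: Z_def)

lemma Laurent_inverse_Z [simp]: "inverse Z \<in> Laurent"
  using LaurentI[of 1 1] by (simp add: divide_inverse)

lemma Laurent_power: "f \<in> Laurent \<Longrightarrow> f ^ n \<in> Laurent"
  by (induction n) (simp_all add: Laurent_mult)

lemmas Laurent_closed = Laurent_add Laurent_mult Laurent_uminus Laurent_diff Laurent_power

lemma Laurent_half: "f \<in> Laurent \<Longrightarrow> f / 2 \<in> Laurent"
  using Laurent_mult[OF Laurent_cst[of "1 / 2"], of f] by (simp add: cst_half)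

lemma Xvar_Laurent [simp]: "Xvar \<in> Laurent"
  unfolding Xvar_def by (intro Laurent_half Laurent_closed Laurent_Z Laurent_inverse_Z)

lemma Delta_Laurent [simp]: "Delta \<in> Laurent"
  unfolding Delta_def by (intro Laurent_closed Laurent_Z Laurent_inverse_Z)

text \<open>
  \<open>\<complex>[z\<^sup>\<plusminus>]\<close> is generated by \<open>1\<close> and \<open>z\<close> as a module over \<open>\<complex>[x]\<close>, because
  \<open>z\<^sup>m\<^sup>+\<^sup>1 = 2 x z\<^sup>m - z\<^sup>m\<^sup>-\<^sup>1\<close> in both directions of \<open>m\<close>. Multiplication by \<open>x\<close> commutes with the
  reflection, which makes this more convenient than induction along powers of \<open>z\<close>.
\<close>

lemma Laurent_induct [consumes 1, case_names one Z add cst Xvar]: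
  assumes f: "f \<in> Laurent"
    and one: "P 1" and Z: "P Z"
    and add: "\<And>f g. f \<in> Laurent \<Longrightarrow> g \<in> Laurent \<Longrightarrow> P f \<Longrightarrow> P g \<Longrightarrow> P (f + g)"
    and cst: "\<And>c f. f \<in> Laurent \<Longrightarrow> P f \<Longrightarrow> P (cst c * f)"
    and X: "\<And>f. f \<in> Laurent \<Longrightarrow> P f \<Longrightarrow> P (Xvar * f)"
  shows "P f"
proof -
  have L: "Z powi m \<in> Laurent" for m
    by (cases m) (auto simp: power_int_def power_inverse intro!: Laurent_power
        simp flip: power_inverse)
  have comb: "P (cst 2 * (Xvar * f) + cst (- 1) * g)"
    if "f \<in> Laurent" "g \<in> Laurent" "P f" "P g" for f g
    using that by (intro add cst X Laurent_mult) auto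
  have X2: "2 * Xvar * Z = Z * Z + 1" by (simp add: two_Xvar distrib_right)
  have step: "Z powi (n + 1) = Z powi n * Z" for n
    by (rule power_int_add_1) simp
  have rec: "cst 2 * (Xvar * Z powi (n + 1)) + cst (- 1) * Z powi n = Z powi (n + 1 + 1)" for n
    unfolding step cst_uminus cst_1 cst_numeral using X2 by algebra
  have rec': "cst 2 * (Xvar * Z powi n) + cst (- 1) * Z powi (n + 1) = Z powi (n - 1)" for n
  proof -
    have "Z powi n = Z powi (n - 1) * Z" using step[of "n - 1"] by simp
    thus ?thesis unfolding step cst_uminus cst_1 cst_numeral using X2 by algebra
  qed
  have powi: "P (Z powi m) \<and> P (Z powi (m + 1))" for m
  proof (induction m rule: int_induct[where k = 0])
    case base
    show ?case using one Z by simp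
  next
    case (step1 m)
    thus ?case using comb[OF L L, of "m + 1" m] unfolding rec by blast
  next
    case (step2 m)
    thus ?case using comb[OF L L, of m "m + 1"] unfolding rec' by simp
  qed
  have Lp: "to_fract p \<in> Laurent" for p using LaurentI[of p 0] by simp
  have "P (to_fract p * Z powi m)" for p m
  proof (induction p arbitrary: m)
    case 0
    show ?case using cst[OF L, of m 0] powi[of m] by simp
  next
    case (pCons a p)
    have "to_fract (pCons a p) * Z powi m = cst a * Z powi m + to_fract p * Z powi (m + 1)"
      unfolding to_fract_pCons step by (simp only: distrib_right mult.assoc mult.left_commute)
        (simp only: ac_simps)
    thus ?case using pCons.IH[of "m + 1"] powi[of m] L Lp by (simp add: add cst Laurent_mult)
  qed
  moreover obtain p n where "f = to_fract p / Z ^ n" using f unfolding Laurent_def by blast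
  hence "f = to_fract p * Z powi (- int n)" by (simp add: power_int_minus divide_inverse)
  ultimately show ?thesis by simp
qed

lemma Laurent_sact: "f \<in> Laurent \<Longrightarrow> sact f \<in> Laurent"
  by (induction rule: Laurent_induct)
    (simp_all add: sact_Z sact_add sact_mult sact_Xvar Laurent_closed)

lemma Cx_add: "f \<in> Cx \<Longrightarrow> g \<in> Cx \<Longrightarrow> f + g \<in> Cx"
  unfolding Cx_def by (auto simp flip: map_poly_cst_add poly_add)

lemma Cx_cst_mult: "f \<in> Cx \<Longrightarrow> cst c * f \<in> Cx"
proof -
  assume "f \<in> Cx"
  then obtain p where "f = poly (map_poly cst p) Xvar" by (auto simp: Cx_def)
  hence "cst c * f = poly (map_poly cst ([:c:] * p)) Xvar"
    unfolding map_poly_cst_mult by (simp add: map_poly_pCons)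
  thus ?thesis unfolding Cx_def by blast
qed

lemma Cx_Laurent: "f \<in> Cx \<Longrightarrow> f \<in> Laurent"
proof -
  have "poly (map_poly cst p) Xvar \<in> Laurent" for p
    by (induction p) (simp_all add: map_poly_pCons Laurent_closed)
  thus "f \<in> Cx \<Longrightarrow> f \<in> Laurent" by (auto simp: Cx_def)
qed

text \<open>
  Symmetrization is linear over \<open>\<complex>[x]\<close>, so it is enough that \<open>1\<close> and \<open>z\<close> go to \<open>2\<close> and \<open>2x\<close>.
\<close>

lemma symmetrization_Cx: "f \<in> Laurent \<Longrightarrow> f + sact f \<in> Cx"
proof (induction rule: Laurent_induct)
  case one
  show ?case using Cx_cst_mult[OF Cx_1, of 2] by simp
next
  case Z
  show ?case using Cx_cst_mult[OF Cx_mult[OF Cx_1], of 2] by (simp add: sact_Z two_Xvar)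
next
  case (add f g)
  thus ?case using Cx_add[of "f + sact f" "g + sact g"] by (simp add: sact_add algebra_simps)
next
  case (cst c f)
  thus ?case using Cx_cst_mult[of "f + sact f" c] by (simp add: sact_mult algebra_simps)
next
  case (Xvar f)
  thus ?case using Cx_mult[of "f + sact f"] by (simp add: sact_mult sact_Xvar algebra_simps)
qed


section \<open>Localized Laurent polynomials and symbols\<close>

lemma Laurent_DeltaI: "f \<in> Laurent \<Longrightarrow> f / Delta ^ n \<in> Laurent_Delta"
  unfolding Laurent_Delta_def by blast

lemma Laurent_imp_Laurent_Delta: "f \<in> Laurent \<Longrightarrow> f \<in> Laurent_Delta"
  using Laurent_DeltaI[of f 0] by simp

lemma Laurent_Delta_0 [simp]: "0 \<in> Laurent_Delta"
  by (simp add: Laurent_imp_Laurent_Delta)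

lemma Laurent_Delta_add:
  assumes "f \<in> Laurent_Delta" "g \<in> Laurent_Delta"
  shows "f + g \<in> Laurent_Delta"
proof -
  obtain a n b m where ab: "f = a / Delta ^ n" "g = b / Delta ^ m" "a \<in> Laurent" "b \<in> Laurent"
    using assms unfolding Laurent_Delta_def by blast
  have "f + g = (a * Delta ^ m + b * Delta ^ n) / Delta ^ (n + m)"
    using Delta_nz by (simp add: ab field_simps power_add)
  thus ?thesis using ab by (simp add: Laurent_DeltaI Laurent_closed)
qed

lemma Laurent_Delta_mult:
  assumes "f \<in> Laurent_Delta" "g \<in> Laurent_Delta"
  shows "f * g \<in> Laurent_Delta"
proof -
  obtain a n b m where ab: "f = a / Delta ^ n" "g = b / Delta ^ m" "a \<in> Laurent" "b \<in> Laurent"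
    using assms unfolding Laurent_Delta_def by blast
  have "f * g = (a * b) / Delta ^ (n + m)" by (simp only: ab power_add times_divide_times_eq)
  thus ?thesis using ab Laurent_DeltaI[OF Laurent_mult] by metis
qed

lemma Laurent_Delta_uminus: "f \<in> Laurent_Delta \<Longrightarrow> - f \<in> Laurent_Delta"
  unfolding Laurent_Delta_def by (auto simp flip: minus_divide_left intro: Laurent_uminus)
    (metis Laurent_uminus minus_divide_left)

lemma Laurent_Delta_sact: "f \<in> Laurent_Delta \<Longrightarrow> sact f \<in> Laurent_Delta"
proof -
  assume "f \<in> Laurent_Delta"
  then obtain a n where f: "f = a / Delta ^ n" and a: "a \<in> Laurent"
    unfolding Laurent_Delta_def by blast
  have "sact f = (if even n then sact a else - sact a) / Delta ^ n"
    by (simp add: f sact_divide sact_power sact_Delta)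
  thus ?thesis
    by (simp add: Laurent_DeltaI Laurent_uminus Laurent_sact a del: divide_minus_left)
qed

lemma Laurent_Delta_diff: "f \<in> Laurent_Delta \<Longrightarrow> g \<in> Laurent_Delta \<Longrightarrow> f - g \<in> Laurent_Delta"
  using Laurent_Delta_add[of f "- g"] Laurent_Delta_uminus by simp

lemma Laurent_Delta_power: "f \<in> Laurent_Delta \<Longrightarrow> f ^ n \<in> Laurent_Delta"
  by (induction n) (simp_all add: Laurent_Delta_mult Laurent_imp_Laurent_Delta)

lemma Laurent_Delta_gens [simp]: "Z \<in> Laurent_Delta" "inverse Z \<in> Laurent_Delta"
    "cst a \<in> Laurent_Delta" "1 \<in> Laurent_Delta" "numeral n \<in> Laurent_Delta"
  by (simp_all add: Laurent_imp_Laurent_Delta)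

lemmas Laurent_Delta_closed = Laurent_Delta_add Laurent_Delta_diff Laurent_Delta_mult
  Laurent_Delta_uminus Laurent_Delta_power

lemma symbols_0 [simp]: "0 \<in> symbols"
  by (simp add: symbols_def)

lemma symbols_pCons [simp]:
  "pCons a c \<in> symbols \<longleftrightarrow> a \<in> Laurent_Delta \<and> c \<in> symbols"
  unfolding symbols_def by (auto simp: coeff_pCons split: nat.splits)

lemma symbols_add: "a \<in> symbols \<Longrightarrow> b \<in> symbols \<Longrightarrow> a + b \<in> symbols"
  by (simp add: symbols_def Laurent_Delta_add)

lemma symbols_uminus: "a \<in> symbols \<Longrightarrow> - a \<in> symbols"
  by (simp add: symbols_def Laurent_Delta_uminus)


section \<open>Composition and reflection of differential operators\<close>

lemma diffop_0 [simp]: "diffop 0 f = 0"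
  by (simp add: diffop_def)

text \<open>
  This recursion lets composition and reflection of operators be treated by induction on the symbol,
  without binomial sums: prepending a coefficient precomposes the rest with \<open>\<theta>\<close>.
\<close>

lemma diffop_pCons: "diffop (pCons a c) f = a * f + diffop c (theta f)"
proof -
  have "degree (pCons a c) < Suc (Suc (degree c))"
    by (simp add: degree_pCons_le less_Suc_eq_le)
  hence "diffop (pCons a c) f
      = (\<Sum>i<Suc (Suc (degree c)). coeff (pCons a c) i * (theta ^^ i) f)"
    by (rule diffop_lessThan)
  also have "\<dots> = a * f + (\<Sum>i<Suc (degree c). coeff c i * (theta ^^ i) (theta f))"
    by (subst sum.lessThan_Suc_shift) (simp only: coeff_pCons_0 coeff_pCons_Suc funpow_0
        funpow_Suc_right o_apply)
  also have "(\<Sum>i<Suc (degree c). coeff c i * (theta ^^ i) (theta f)) = diffop c (theta f)"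
    by (rule diffop_lessThan[symmetric]) simp
  finally show ?thesis .
qed

lemma diffop_neg_poly: "diffop (- c) f = - diffop c f"
  by (simp add: diffop_def sum_negf)

lemma diffop_smult: "diffop (smult a c) f = a * diffop c f"
  by (induction c arbitrary: f) (simp_all add: diffop_pCons algebra_simps)

lemma theta_diffop: "theta (diffop c f) = diffop (map_poly theta c + pCons 0 c) f"
proof (induction c arbitrary: f)
  case (pCons a c)
  thus ?case
    by (simp add: diffop_add diffop_pCons map_poly_pCons theta_add theta_mult algebra_simps)
qed simp

lemma diffop_comp: "\<exists>d. \<forall>f. diffop a (diffop b f) = diffop d f"
proof (induction a arbitrary: b)
  case 0
  show ?case by (intro exI[of _ 0]) simp
next
  case (pCons x a)
  obtain d where "\<And>f. diffop a (theta (diffop b f)) = diffop d f"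
    using pCons.IH[of "map_poly theta b + pCons 0 b"] unfolding theta_diffop by blast
  thus ?case
    by (intro exI[of _ "smult x b + d"]) (simp add: diffop_pCons diffop_add diffop_smult)
qed

text \<open>
  Differential operators are determined by their restriction to \<open>\<complex>[x]\<close>, so intertwining relations
  may be tested there.
\<close>

lemma diffop_comp_eqI:
  assumes "\<And>f. f \<in> Cx \<Longrightarrow> diffop a (diffop b f) = diffop c (diffop d f)"
  shows "diffop a \<circ> diffop b = diffop c \<circ> diffop d"
proof -
  obtain p q where pq: "\<And>f. diffop a (diffop b f) = diffop p f"
      "\<And>f. diffop c (diffop d f) = diffop q f"
    using diffop_comp by metis
  have "p = q" using assms by (intro diffop_inj_Cx) (simp add: pq)
  thus ?thesis by (simp add: fun_eq_iff pq)
qed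

text \<open>
  Moving the reflection to the right replaces \<open>\<Sum>\<^sub>i c\<^sub>i \<theta>\<^sup>i\<close> by \<open>\<Sum>\<^sub>i (-1)\<^sup>i s(c\<^sub>i) \<theta>\<^sup>i\<close>. In the induction the
  sign appears as the negation of the tail.
\<close>

lemma sact_diffop:
  assumes "c \<in> symbols"
  shows "\<exists>d\<in>symbols. \<forall>f. sact (diffop c f) = diffop d (sact f)"
  using assms
proof (induction c)
  case 0
  show ?case by (intro bexI[of _ 0]) simp_all
next
  case (pCons a c)
  then obtain d where "d \<in> symbols" "\<And>f. sact (diffop c f) = diffop d (sact f)" by auto
  with pCons.prems show ?case
    by (intro bexI[of _ "pCons (sact a) (- d)"])
      (simp_all add: diffop_pCons sact_add sact_mult sact_theta diffop_uminus diffop_neg_poly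
        Laurent_Delta_sact symbols_uminus)
qed

lemma Sym_diffrefl:
  assumes "T \<in> diffrefl_ops"
  shows "Sym T \<in> diffrefl_ops"
proof -
  obtain a b where ab: "a \<in> symbols" "b \<in> symbols"
    and T: "T = (\<lambda>f. diffop a f + diffop b (sact f))"
    using assms by (auto simp: diffrefl_ops_def)
  obtain a' b' where ab': "a' \<in> symbols" "b' \<in> symbols"
    and s: "\<And>f. sact (diffop a f) = diffop a' (sact f)" "\<And>f. sact (diffop b f) = diffop b' (sact f)"
    using sact_diffop ab by metis
  have "Sym T = (\<lambda>f. diffop (a + b') f + diffop (b + a') (sact f))"
    by (simp add: fun_eq_iff Sym_def T sact_add s diffop_add)
  thus ?thesis unfolding diffrefl_ops_def using ab ab' symbols_add by blast
qed


section \<open>Calculus with the poles at 1 and -1\<close>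

definition inv_Zm1 :: ratfun where "inv_Zm1 = inverse (Z - 1)"
definition inv_Zp1 :: ratfun where "inv_Zp1 = inverse (Z + 1)"

text \<open>
  These three relations determine \<open>z\<^sup>-\<^sup>1\<close>, \<open>(z - 1)\<^sup>-\<^sup>1\<close> and \<open>(z + 1)\<^sup>-\<^sup>1\<close>. Fed to the method \<open>algebra\<close> they
  decide identities between the rational functions that occur here without case distinctions on
  vanishing denominators.
\<close>

lemma ratfun_rels:
  "inv_Zm1 * (Z - 1) = 1" "inv_Zp1 * (Z + 1) = 1" "inverse Z * Z = 1"
  using Z_neq_1 Z_neq_m1 by (simp_all add: inv_Zm1_def inv_Zp1_def)

lemma theta_inv:
  "theta inv_Zm1 = - (Z * inv_Zm1 ^ 2)" "theta inv_Zp1 = - (Z * inv_Zp1 ^ 2)"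
  by (simp_all add: inv_Zm1_def inv_Zp1_def theta_inverse theta_diff theta_add theta_Z)

lemma sact_inv: "sact inv_Zm1 = - (Z * inv_Zm1)" "sact inv_Zp1 = Z * inv_Zp1"
proof -
  have "inverse (inverse Z - 1) = - (Z * inv_Zm1)"
    using ratfun_rels by (intro inverse_unique) algebra
  thus "sact inv_Zm1 = - (Z * inv_Zm1)" by (simp add: inv_Zm1_def sact_inverse sact_diff sact_Z)
  have "inverse (inverse Z + 1) = Z * inv_Zp1"
    using ratfun_rels by (intro inverse_unique) algebra
  thus "sact inv_Zp1 = Z * inv_Zp1" by (simp add: inv_Zp1_def sact_inverse sact_add sact_Z)
qed

lemma inv_coeffs:
  "1 / (1 - inverse Z) = Z * inv_Zm1"
  "1 / (1 + inverse Z) = Z * inv_Zp1"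
  "1 / (Z - inverse Z) = Z * inv_Zm1 * inv_Zp1"
  "1 / (1 - inverse Z ^ 2) = Z ^ 2 * inv_Zm1 * inv_Zp1"
proof -
  have *: "1 / f = g" if "f * g = 1" for f g :: ratfun
    using inverse_unique[OF that] by (simp add: divide_inverse)
  show "1 / (1 - inverse Z) = Z * inv_Zm1" using ratfun_rels by (intro *) algebra
  show "1 / (1 + inverse Z) = Z * inv_Zp1" using ratfun_rels by (intro *) algebra
  show "1 / (Z - inverse Z) = Z * inv_Zm1 * inv_Zp1" using ratfun_rels by (intro *) algebra
  show "1 / (1 - inverse Z ^ 2) = Z ^ 2 * inv_Zm1 * inv_Zp1" using ratfun_rels by (intro *) algebra
qed

lemma Laurent_Delta_inv [simp]: "inv_Zm1 \<in> Laurent_Delta" "inv_Zp1 \<in> Laurent_Delta"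
proof -
  have "1 / Delta = Z * inv_Zm1 * inv_Zp1"
    unfolding Delta_def by (rule inv_coeffs)
  hence *: "f / Delta ^ 1 = f * (Z * inv_Zm1 * inv_Zp1)" for f
    by (simp add: divide_inverse)
  have "inv_Zm1 = (1 + inverse Z) / Delta ^ 1" "inv_Zp1 = (1 - inverse Z) / Delta ^ 1"
    unfolding * using ratfun_rels by algebra+
  thus "inv_Zm1 \<in> Laurent_Delta" "inv_Zp1 \<in> Laurent_Delta"
    by (metis Laurent_DeltaI Laurent_1 Laurent_inverse_Z Laurent_add Laurent_diff)+
qed

lemmas theta_rules = theta_add theta_diff theta_mult theta_uminus theta_power2 theta_cst
  theta_numeral theta_Z theta_inverse_Z theta_inv theta_1 theta_0
lemmas sact_rules = sact_add sact_diff sact_mult sact_uminus sact_power sact_cst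
  sact_numeral sact_Z sact_inverse_Z sact_inv sact_1 sact_0


section \<open>Squares of Dunkl operators\<close>

definition refl_coeff :: "root_mult \<Rightarrow> ratfun" where
  "refl_coeff k = cst (fst k) * (1 / (1 - inverse Z)) + 2 * cst (snd k) * (1 / (1 - inverse Z ^ 2))"

lemma Dop_eq: "Dop k f = theta f + refl_coeff k * (f - sact f) - cst (rho k) * f"
  by (simp add: Dop_def refl_coeff_def algebra_simps)

lemma refl_coeff_expand:
  "refl_coeff k = cst (fst k) * (Z * inv_Zm1) + 2 * cst (snd k) * (Z ^ 2 * inv_Zm1 * inv_Zp1)"
  unfolding refl_coeff_def inv_coeffs ..

lemma rho_shift: "cst (rho (k + (a, b))) = cst (rho k) + cst (a / 2 + b)"
  by (simp add: rho_def add_divide_distrib cst_add)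

lemma two_half: "2 * cst (1 / 2) = 1"
  using two_nz by (simp add: cst_half)

text \<open>
  Writing the factor \<open>1/2\<close> as a constant \<open>h\<close> with \<open>2h = 1\<close> gives every relation passed to \<open>algebra\<close>
  integer coefficients and leading coefficient \<open>1\<close> in \<open>\<rho>\<close>, so that no division by \<open>2\<close> is needed.
\<close>

lemma cst_rho: "cst (rho k) = (cst (fst k) + 2 * cst (snd k)) * cst (1 / 2)"
  by (simp add: rho_def cst_half cst_add cst_mult two_nz)

lemma sact_refl_coeff: "sact (refl_coeff k) = 2 * cst (rho k) - refl_coeff k"
  unfolding refl_coeff_expand cst_rho sact_rules using ratfun_rels two_half by algebra

lemma Dop_add: "Dop k (f + g) = Dop k f + Dop k g"
  by (simp add: Dop_eq theta_add sact_add algebra_simps)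

lemma Dop_cst_mult: "Dop k (cst c * f) = cst c * Dop k f"
  by (simp add: Dop_eq theta_mult sact_mult algebra_simps)

text \<open>
  The relation \<open>s D\<^sub>k + D\<^sub>k s = -2 \<rho>(k)\<close> of the graded Hecke algebra. It rests on
  \<open>u + s(u) = 2 \<rho>(k)\<close> for the reflection coefficient \<open>u\<close> (\<open>sact_refl_coeff\<close>), which comes from
  \<open>1 / (1 - w\<^sup>-\<^sup>1) + 1 / (1 - w) = 1\<close> for \<open>w = z\<close> and \<open>w = z\<^sup>2\<close>.
\<close>

lemma sact_Dop: "sact (Dop k f) = - Dop k (sact f) - 2 * cst (rho k) * f"
  by (simp add: Dop_eq sact_add sact_diff sact_mult sact_theta sact_refl_coeff algebra_simps)

text \<open>
  Moving \<open>s\<close> past \<open>D\<close> twice produces the terms \<open>-2 \<rho> D\<close> and \<open>+2 \<rho> D\<close>, which cancel.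
\<close>

lemma sact_Dop_Dop: "sact (Dop k (Dop k f)) = Dop k (Dop k (sact f))"
proof -
  have "Dop k (- g) = - Dop k g" for g
    using Dop_cst_mult[of k "- 1" g] by (simp add: cst_uminus)
  moreover have "Dop k (2 * cst c * g) = 2 * cst c * Dop k g" for c g
    using Dop_cst_mult[of k "2 * c" g] by (simp add: cst_mult)
  ultimately show ?thesis
    using Dop_add[of k "- Dop k (sact f)" "- (2 * cst (rho k) * f)"]
    by (simp add: sact_Dop)
qed

text \<open>
  If \<open>s f = f\<close>, then \<open>D f = \<theta> f - \<rho> f\<close> and the reflection sends \<open>\<theta> f\<close> to \<open>-\<theta> f\<close>, so \<open>\<theta> f\<close> acquires the
  coefficient \<open>2u - 2\<rho>\<close> in \<open>D\<^sup>2 f\<close>. This is the first-order coefficient of \<open>ML\<close>, as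
  \<open>2 / (1 - w\<^sup>-\<^sup>1) - 1 = (1 + w\<^sup>-\<^sup>1) / (1 - w\<^sup>-\<^sup>1)\<close> for \<open>w = z\<close> and \<open>w = z\<^sup>2\<close>.
\<close>

lemma MLop_on_invariants:
  assumes "sact f = f"
  shows "MLop k f = Dop k (Dop k f)"
proof -
  have s: "sact (theta f) = - theta f" by (simp add: sact_theta assms)
  have "Dop k (Dop k f)
      = theta (theta f) + (2 * refl_coeff k - 2 * cst (rho k)) * theta f + cst (rho k) ^ 2 * f"
    by (simp add: Dop_eq assms s theta_diff theta_mult sact_diff sact_mult algebra_simps
        power2_eq_square)
  also have "2 * refl_coeff k - 2 * cst (rho k)
      = cst (fst k) * ((1 + inverse Z) / (1 - inverse Z))
        + 2 * cst (snd k) * ((1 + inverse Z ^ 2) / (1 - inverse Z ^ 2))"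
  proof -
    have "(1 + inverse Z) / (1 - inverse Z) = (1 + inverse Z) * (1 / (1 - inverse Z))"
      "(1 + inverse Z ^ 2) / (1 - inverse Z ^ 2) = (1 + inverse Z ^ 2) * (1 / (1 - inverse Z ^ 2))"
      by simp_all
    thus ?thesis
      unfolding inv_coeffs refl_coeff_expand cst_rho using ratfun_rels two_half by algebra
  qed
  finally show ?thesis
    by (simp add: MLop_def algebra_simps cst_mult power2_eq_square)
qed

lemma MLop_diffop: "\<exists>c. MLop k = diffop c"
proof -
  have "MLop k = diffop [:cst (rho k ^ 2), cst (fst k) * ((1 + inverse Z) / (1 - inverse Z))
     + 2 * cst (snd k) * ((1 + inverse Z ^ 2) / (1 - inverse Z ^ 2)), 1:]"
    by (simp add: fun_eq_iff MLop_def diffop_pCons algebra_simps)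
  thus ?thesis by blast
qed


section \<open>Symmetrization of shift operators\<close>

lemma Sym_Dop_Dop:
  assumes "S \<circ> Dop k = Dop k' \<circ> S"
  shows "Sym S \<circ> (Dop k \<circ> Dop k) = (Dop k' \<circ> Dop k') \<circ> Sym S"
proof -
  have "S (Dop k f) = Dop k' (S f)" for f using fun_cong[OF assms] by simp
  thus ?thesis by (simp add: fun_eq_iff Sym_def Dop_add sact_Dop_Dop)
qed

lemma Sym_Cx:
  assumes "S ` Laurent \<subseteq> Laurent"
  shows "Sym S ` Cx \<subseteq> Cx"
  using assms Cx_Laurent symmetrization_Cx by (auto simp: Sym_def)

lemma beta_on_invariants:
  assumes "T \<in> diffrefl_ops" "sact f = f"
  shows "beta T f = T f"
proof -
  obtain a b where "a \<in> symbols" "b \<in> symbols" "T = (\<lambda>f. diffop a f + diffop b (sact f))"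
    using assms(1) by (auto simp: diffrefl_ops_def)
  thus ?thesis using beta_eq[of a b T] assms(2) by simp
qed

lemma beta_diffop:
  assumes "T \<in> diffrefl_ops"
  shows "\<exists>c\<in>symbols. beta T = diffop c"
proof -
  obtain a b where ab: "a \<in> symbols" "b \<in> symbols" "T = (\<lambda>f. diffop a f + diffop b (sact f))"
    using assms by (auto simp: diffrefl_ops_def)
  hence "beta T = diffop (a + b)" using beta_eq[of a b T] by (simp add: fun_eq_iff diffop_add)
  thus ?thesis using ab symbols_add by blast
qed

text \<open>
  Both sides of the intertwining relation are differential operators, so it is enough to compare
  them on \<open>\<complex>[x]\<close>, where \<open>beta\<close> can be dropped and \<open>MLop\<close> is the square of \<open>Dop\<close>.
\<close>

lemma beta_MLop:
  assumes T: "T \<in> diffrefl_ops" and Cx: "T ` Cx \<subseteq> Cx"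
    and inter: "T \<circ> (Dop k \<circ> Dop k) = (Dop k' \<circ> Dop k') \<circ> T"
  shows "beta T \<circ> MLop k = MLop k' \<circ> beta T"
proof -
  obtain b m m' where d: "beta T = diffop b" "MLop k = diffop m" "MLop k' = diffop m'"
    using beta_diffop[OF T] MLop_diffop by metis
  have "beta T (MLop k f) = MLop k' (beta T f)" if f: "f \<in> Cx" for f
  proof -
    have sf: "sact f = f" using f by (rule sact_Cx)
    have "beta T (MLop k f) = T (Dop k (Dop k f))"
      using T sf by (simp add: beta_on_invariants MLop_on_invariants sact_Dop_Dop)
    also have "\<dots> = Dop k' (Dop k' (T f))" using fun_cong[OF inter, of f] by simp
    also have "\<dots> = MLop k' (beta T f)"
      using f Cx sact_Cx[of "T f"] by (simp add: MLop_on_invariants beta_on_Cx[OF T f] image_subset_iff)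
    finally show ?thesis .
  qed
  thus ?thesis unfolding d by (rule diffop_comp_eqI)
qed

lemma Sym_nonsym_shift_op:
  assumes "nonsym_shift_op k l S"
  shows "Sym S \<in> diffrefl_ops" "Sym S ` Cx \<subseteq> Cx"
    and "Sym S \<circ> (Dop k \<circ> Dop k) = (Dop (k + l) \<circ> Dop (k + l)) \<circ> Sym S"
    and "beta (Sym S) \<circ> MLop k = MLop (k + l) \<circ> beta (Sym S)"
    and "sym_shift_op k l (beta (Sym S))"
proof -
  show T: "Sym S \<in> diffrefl_ops" and Cx: "Sym S ` Cx \<subseteq> Cx"
    and inter: "Sym S \<circ> (Dop k \<circ> Dop k) = (Dop (k + l) \<circ> Dop (k + l)) \<circ> Sym S"
    using assms Sym_diffrefl Sym_Cx Sym_Dop_Dop unfolding nonsym_shift_op_def by auto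
  show shift: "beta (Sym S) \<circ> MLop k = MLop (k + l) \<circ> beta (Sym S)"
    by (rule beta_MLop[OF T Cx inter])
  have "beta (Sym S) \<in> diff_ops"
    using beta_diffop[OF T] unfolding diff_ops_def by auto
  moreover have "beta (Sym S) ` Cx \<subseteq> Cx"
    using Cx beta_on_Cx[OF T] by (simp add: image_subset_iff)
  ultimately show "sym_shift_op k l (beta (Sym S))"
    unfolding sym_shift_op_def using shift by blast
qed


section \<open>First-order shift operators\<close>

text \<open>
  Up to multiplication by the Laurent polynomial \<open>c (z - z\<^sup>-\<^sup>1) / 2\<close>, the operator commutes with \<open>x\<close>.
  Hence regularity of its values only has to be checked on the module generators \<open>1\<close> and \<open>z\<close>.
\<close>

lemma first_order_Laurent:
  assumes T: "\<And>f. T f = c * theta f + d * f + e * sact f"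
    and "T 1 \<in> Laurent" "T Z \<in> Laurent" and c: "c * Delta \<in> Laurent"
  shows "T ` Laurent \<subseteq> Laurent"
proof
  fix g assume "g \<in> T ` Laurent"
  then obtain f where "f \<in> Laurent" and g: "g = T f" by blast
  from this(1) have "T f \<in> Laurent"
  proof (induction rule: Laurent_induct)
    case (add f g)
    have "T (f + g) = T f + T g" by (simp add: T theta_add sact_add algebra_simps)
    thus ?case using add by (simp add: Laurent_add)
  next
    case (cst a f)
    have "T (cst a * f) = cst a * T f" by (simp add: T theta_mult sact_mult algebra_simps)
    thus ?case using cst by (simp add: Laurent_mult)
  next
    case (Xvar f)
    have "T (Xvar * f) = Xvar * T f + (c * Delta) / 2 * f"
      by (simp add: T theta_mult sact_mult sact_Xvar theta_Xvar algebra_simps)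
    thus ?case using Xvar c by (simp add: Laurent_closed Laurent_half)
  qed (use assms in simp_all)
  thus "g \<in> Laurent" by (simp add: g)
qed

text \<open>
  The four equations are the coefficients of \<open>\<theta>\<close>, \<open>\<theta> s\<close>, \<open>1\<close> and \<open>s\<close> in \<open>T D\<^sub>k = D\<^sub>k' T\<close>. The coefficients
  of \<open>\<theta>\<^sup>2\<close> agree anyway, and those of \<open>\<theta>\<^sup>2 s\<close> vanish because neither
  \<open>T\<close> nor \<open>D\<close> has a term in \<open>\<theta> s\<close>.
\<close>

lemma first_order_Dop:
  assumes T: "\<And>f. T f = c * theta f + d * f + e * sact f"
    and sc: "sact c = - c"
    and u: "u = refl_coeff k" and v: "v = refl_coeff k'"
    and r: "r = cst (rho k)" and r': "r' = cst (rho k')"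
    and c1: "theta c = c * (u - v + r' - r)"
    and e1: "2 * e = c * (v - u)"
    and d0: "c * theta u + d * (u - r) - e * (2 * r - u) = theta d + v * (d - sact e) - r' * d"
    and e0: "- c * theta u - d * u + e * (r - u) = theta e + v * (e - sact d) - r' * e"
  shows "T \<circ> Dop k = Dop k' \<circ> T"
proof
  fix f
  define g g1 where "g = sact f" and "g1 = sact (theta f)"
  have "T (Dop k f) = c * theta (theta f) + (c * (u - r) + d) * theta f + (c * u + e) * g1
     + (c * theta u + d * (u - r) - e * (2 * r - u)) * f
     + (- c * theta u - d * u + e * (r - u)) * g"
    by (simp add: T Dop_eq theta_add theta_diff theta_mult sact_add sact_diff sact_mult
        theta_sact sact_refl_coeff g_def g1_def u r algebra_simps)
  also have "(c * (u - r) + d) = theta c + d + c * (v - r')" by (simp add: c1 algebra_simps)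
  also have "c * u + e = v * c - e" using e1 by algebra
  also have "c * theta (theta f) + (theta c + d + c * (v - r')) * theta f + (v * c - e) * g1
     + (c * theta u + d * (u - r) - e * (2 * r - u)) * f
     + (- c * theta u - d * u + e * (r - u)) * g = Dop k' (T f)"
    \<comment> \<open>The reflection coefficient \<open>v\<close> of the target multiplies \<open>T f - s (T f)\<close>; with \<open>s c = -c\<close> this
      is where \<open>v c\<close> enters in front of both \<open>\<theta> f\<close> and \<open>s \<theta> f\<close>.\<close>
    unfolding d0 e0
    by (simp add: T Dop_eq theta_add theta_diff theta_mult sact_add sact_diff sact_mult
        theta_sact sc g_def g1_def v r' algebra_simps)
  finally show "(T \<circ> Dop k) f = (Dop k' \<circ> T) f" by simp
qed

lemma first_order_diffrefl:
  assumes "T = (\<lambda>f. c * theta f + d * f + e * sact f)"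
    and "c \<in> Laurent_Delta" "d \<in> Laurent_Delta" "e \<in> Laurent_Delta"
  shows "T \<in> diffrefl_ops"
proof -
  have "T = (\<lambda>f. diffop [:d, c:] f + diffop [:e:] (sact f))"
    by (simp add: assms(1) diffop_pCons algebra_simps)
  moreover have "[:d, c:] \<in> symbols" "[:e:] \<in> symbols" using assms by simp_all
  ultimately show ?thesis unfolding diffrefl_ops_def by blast
qed

text \<open>
  Since \<open>s c \<theta> = -s(c) \<theta> s = c \<theta> s\<close>, symmetrization adds \<open>c \<theta> s\<close> to \<open>c \<theta>\<close>, which \<open>beta\<close> turns into
  \<open>2 c \<theta>\<close>. The terms of order zero contribute \<open>d + e\<close> and its reflection.
\<close>

lemma beta_Sym_first_order:
  assumes T: "T = (\<lambda>f. c * theta f + d * f + e * sact f)"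
    and L: "c \<in> Laurent_Delta" "d \<in> Laurent_Delta" "e \<in> Laurent_Delta"
    and sc: "sact c = - c" and de: "d + e + sact (d + e) = 2 * h"
  shows "beta (Sym T) = (\<lambda>f. 2 * (c * theta f + h * f))"
proof -
  have "beta (Sym T) = (\<lambda>f. diffop [:d + sact e, c:] f + diffop [:e + sact d, c:] f)"
  proof (rule beta_eq)
    show "Sym T = (\<lambda>f. diffop [:d + sact e, c:] f + diffop [:e + sact d, c:] (sact f))"
      by (simp add: Sym_def T diffop_pCons sact_add sact_mult sc theta_sact algebra_simps)
  qed (use L in \<open>simp_all add: Laurent_Delta_add Laurent_Delta_sact\<close>)
  also have "\<dots> = (\<lambda>f. 2 * (c * theta f) + (d + e + sact (d + e)) * f)"
    by (simp add: fun_eq_iff diffop_pCons sact_add algebra_simps)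
  finally show ?thesis unfolding de by (simp add: fun_eq_iff algebra_simps)
qed

section \<open>The fundamental shift operators\<close>

lemma fundamental_shiftI:
  assumes T: "\<And>f. T f = c * theta f + d * f + e * sact f" and T0: "\<And>f. T0 f = c * theta f + h * f"
    and L: "c \<in> Laurent_Delta" "d \<in> Laurent_Delta" "e \<in> Laurent_Delta"
    and T1: "d + e \<in> Laurent" and TZ: "c * Z + d * Z + e * inverse Z \<in> Laurent"
    and cD: "c * Delta \<in> Laurent"
    and sc: "sact c = - c" and de: "d + e + sact (d + e) = 2 * h"
    and uv: "u = refl_coeff k" "v = refl_coeff (k + l)" "r = cst (rho k)" "r' = cst (rho (k + l))"
    and eqs: "theta c = c * (u - v + r' - r)"
      "2 * e = c * (v - u)"
      "c * theta u + d * (u - r) - e * (2 * r - u) = theta d + v * (d - sact e) - r' * d"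
      "- (c * theta u) - d * u + e * (r - u) = theta e + v * (e - sact d) - r' * e"
  shows "nonsym_shift_op k l T \<and> beta (Sym T) = (\<lambda>f. 2 * T0 f)"
proof
  have T': "T = (\<lambda>f. c * theta f + d * f + e * sact f)" using T by (rule ext)
  have "T \<circ> Dop k = Dop (k + l) \<circ> T"
    by (rule first_order_Dop[where u = u and v = v and r = r and r' = r'])
      (use T sc eqs uv in simp_all)
  moreover have "T ` Laurent \<subseteq> Laurent"
    by (rule first_order_Laurent[of T c d e]) (use T T1 TZ cD in \<open>simp_all add: theta_Z sact_Z\<close>)
  ultimately show "nonsym_shift_op k l T"
    unfolding nonsym_shift_op_def using first_order_diffrefl[OF T' L] by blast
  show "beta (Sym T) = (\<lambda>f. 2 * T0 f)"
    unfolding T0 by (rule beta_Sym_first_order[OF T' L sc de])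
qed

text \<open>
  In the following proofs \<open>H\<close> is the order zero coefficient of the symmetric operator, and the
  non-symmetric one differs from it by multiples of \<open>f\<close> and \<open>s f\<close>. The functions
  \<open>z\<^sup>3 / (z\<^sup>2 - 1)\<^sup>2\<close>, \<open>z / (z - 1)\<^sup>2\<close> and \<open>z / (z + 1)\<^sup>2\<close> are the factors of \<open>f - s f\<close>
  in the definitions of the operators, with common factors cancelled.
\<close>

lemma nsG_plus_shift:
  "nonsym_shift_op k (0, 1) (nsG_plus k) \<and> beta (Sym (nsG_plus k)) = (\<lambda>f. 2 * G_plus k f)"
proof -
  define c H where "c = Z * inv_Zm1 * inv_Zp1"
    and "H = (0 :: ratfun)"
  define d e where "d = - (Z * (Z * inv_Zm1 * inv_Zp1) ^ 2)" and "e = Z * (Z * inv_Zm1 * inv_Zp1) ^ 2"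
  define r where "r = cst (rho k)"
  note expand = c_def d_def e_def H_def refl_coeff_expand fst_add snd_add fst_conv snd_conv
    cst_add cst_uminus cst_0 cst_1 cst_numeral theta_rules sact_rules
  note rels = ratfun_rels two_half cst_rho[of k, folded r_def]
  have de: "d + e = H" by (simp add: d_def e_def H_def)
  show ?thesis
  proof (rule fundamental_shiftI[where c = c and d = d and e = e and h = H and r = r])
    fix f
    have "nsG_plus k f = 1 / (Z - inverse Z) * theta f
        - Z * (f - sact f) * (1 / (Z - inverse Z)) ^ 2"
      by (simp add: nsG_plus_def G_plus_def power_one_over)
    thus "nsG_plus k f = c * theta f + d * f + e * sact f"
      unfolding inv_coeffs c_def d_def e_def H_def by algebra
    show "G_plus k f = c * theta f + H * f"
      unfolding G_plus_def inv_coeffs c_def H_def by algebra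
  next
    show "c \<in> Laurent_Delta" "d \<in> Laurent_Delta" "e \<in> Laurent_Delta"
      unfolding c_def d_def e_def H_def by (intro Laurent_Delta_closed; simp)+
  next
    show "d + e \<in> Laurent" by (simp add: de H_def)
    have "c * Z + d * Z + e * inverse Z = 0" "c * Delta = 1"
      unfolding c_def d_def e_def Delta_def using ratfun_rels by (algebra, algebra)
    thus "c * Z + d * Z + e * inverse Z \<in> Laurent" "c * Delta \<in> Laurent"
      by simp_all
  next
    show "r + 1 = cst (rho (k + (0, 1)))"
      unfolding r_def rho_shift by (simp add: cst_uminus)
  next
    show "sact c = - c"
      unfolding expand using rels by algebra
    show "d + e + sact (d + e) = 2 * H"
      unfolding de by (simp add: H_def sact_rules)
    show "2 * e = c * (refl_coeff (k + (0, 1)) - refl_coeff k)"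
      unfolding expand by (simp add: algebra_simps power2_eq_square)
    show "theta c = c * (refl_coeff k - refl_coeff (k + (0, 1)) + (r + 1) - r)"
      unfolding expand using rels by algebra
    show "c * theta (refl_coeff k) + d * (refl_coeff k - r) - e * (2 * r - refl_coeff k)
        = theta d + refl_coeff (k + (0, 1)) * (d - sact e) - (r + 1) * d"
      unfolding expand using rels by algebra
    show "- (c * theta (refl_coeff k)) - d * refl_coeff k + e * (r - refl_coeff k)
        = theta e + refl_coeff (k + (0, 1)) * (e - sact d) - (r + 1) * e"
      unfolding expand using rels by algebra
  qed (simp_all add: r_def)
qed

lemma nsG_minus_shift:
  "nonsym_shift_op k (0, - 1) (nsG_minus k) \<and> beta (Sym (nsG_minus k)) = (\<lambda>f. 2 * G_minus k f)"
proof -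
  define c H where "c = Z - inverse Z"
    and "H = (cst (fst k) + 2 * cst (snd k) - 1) * (Z + inverse Z) + 2 * cst (fst k)"
  define d e where "d = H + inverse Z" and "e = - Z"
  define r where "r = cst (rho k)"
  note expand = c_def d_def e_def H_def refl_coeff_expand fst_add snd_add fst_conv snd_conv
    cst_add cst_uminus cst_0 cst_1 cst_numeral theta_rules sact_rules
  note rels = ratfun_rels two_half cst_rho[of k, folded r_def]
  show ?thesis
  proof (rule fundamental_shiftI[where c = c and d = d and e = e and h = H and r = r])
    fix f
    show "G_minus k f = c * theta f + H * f"
      unfolding G_minus_def c_def H_def by (simp add: cst_add cst_diff cst_mult)
    thus "nsG_minus k f = c * theta f + d * f + e * sact f"
      unfolding nsG_minus_def d_def e_def by algebra
  next
    show "c \<in> Laurent_Delta" "d \<in> Laurent_Delta" "e \<in> Laurent_Delta"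
      unfolding c_def d_def e_def H_def by (intro Laurent_Delta_closed; simp)+
  next
    show "d + e \<in> Laurent" "c * Z + d * Z + e * inverse Z \<in> Laurent" "c * Delta \<in> Laurent"
      unfolding c_def d_def e_def H_def by (intro Laurent_closed; simp)+
  next
    show "r - 1 = cst (rho (k + (0, - 1)))"
      unfolding r_def rho_shift by (simp add: cst_uminus)
  next
    show "sact c = - c" "d + e + sact (d + e) = 2 * H"
      unfolding expand by (simp_all add: algebra_simps)
    show "2 * e = c * (refl_coeff (k + (0, - 1)) - refl_coeff k)"
      unfolding expand using rels by algebra
    show "theta c = c * (refl_coeff k - refl_coeff (k + (0, - 1)) + (r - 1) - r)"
      unfolding expand using rels by algebra
    show "c * theta (refl_coeff k) + d * (refl_coeff k - r) - e * (2 * r - refl_coeff k)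
        = theta d + refl_coeff (k + (0, - 1)) * (d - sact e) - (r - 1) * d"
      unfolding expand using rels by algebra
    show "- (c * theta (refl_coeff k)) - d * refl_coeff k + e * (r - refl_coeff k)
        = theta e + refl_coeff (k + (0, - 1)) * (e - sact d) - (r - 1) * e"
      unfolding expand using rels by algebra
  qed (simp_all add: r_def)
qed

lemma nsE_plus_shift:
  "nonsym_shift_op k (2, - 1) (nsE_plus k) \<and> beta (Sym (nsE_plus k)) = (\<lambda>f. 2 * E_plus k f)"
proof -
  define c H where "c = (Z + 1) * inv_Zm1"
    and "H = cst (snd k) - cst (1 / 2)"
  define d e where "d = H - Z * inv_Zm1 ^ 2" and "e = Z * inv_Zm1 ^ 2"
  define r where "r = cst (rho k)"
  note expand = c_def d_def e_def H_def refl_coeff_expand fst_add snd_add fst_conv snd_conv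
    cst_add cst_uminus cst_0 cst_1 cst_numeral theta_rules sact_rules
  note rels = ratfun_rels two_half cst_rho[of k, folded r_def]
  have de: "d + e = H" by (simp add: d_def e_def H_def)
  show ?thesis
  proof (rule fundamental_shiftI[where c = c and d = d and e = e and h = H and r = r])
    fix f
    have frac: "(1 + inverse Z) / (1 - inverse Z) = c"
      unfolding divide_inverse inv_coeffs(1,2)[unfolded divide_inverse mult_1] c_def
      using ratfun_rels by algebra
    show "E_plus k f = c * theta f + H * f"
      unfolding E_plus_def frac H_def by (simp add: cst_add cst_diff)
    moreover have "(f - sact f) / (Z - inverse Z) = (f - sact f) * (Z * inv_Zm1 * inv_Zp1)"
      unfolding inv_coeffs(3)[symmetric] by simp
    ultimately show "nsE_plus k f = c * theta f + d * f + e * sact f"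
      unfolding nsE_plus_def frac unfolding c_def d_def e_def using ratfun_rels by algebra
  next
    show "c \<in> Laurent_Delta" "d \<in> Laurent_Delta" "e \<in> Laurent_Delta"
      unfolding c_def d_def e_def H_def by (intro Laurent_Delta_closed; simp)+
  next
    show "d + e \<in> Laurent" by (simp add: de H_def Laurent_closed)
    have "c * Z + d * Z + e * inverse Z = Z + 1 + H * Z"
        "c * Delta = (Z + 1) ^ 2 * inverse Z"
      unfolding c_def d_def e_def Delta_def using ratfun_rels by (algebra, algebra)
    thus "c * Z + d * Z + e * inverse Z \<in> Laurent" "c * Delta \<in> Laurent"
      by (simp_all add: H_def Laurent_closed)
  next
    show "r  = cst (rho (k + (2, - 1)))"
      unfolding r_def rho_shift by (simp add: cst_uminus)
  next
    show "sact c = - c"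
      unfolding expand using rels by algebra
    show "d + e + sact (d + e) = 2 * H"
      unfolding de by (simp add: H_def sact_rules)
    show "2 * e = c * (refl_coeff (k + (2, - 1)) - refl_coeff k)"
      unfolding expand using rels by algebra
    show "theta c = c * (refl_coeff k - refl_coeff (k + (2, - 1)) + (r ) - r)"
      unfolding expand using rels by algebra
    show "c * theta (refl_coeff k) + d * (refl_coeff k - r) - e * (2 * r - refl_coeff k)
        = theta d + refl_coeff (k + (2, - 1)) * (d - sact e) - (r ) * d"
      unfolding expand using rels by algebra
    show "- (c * theta (refl_coeff k)) - d * refl_coeff k + e * (r - refl_coeff k)
        = theta e + refl_coeff (k + (2, - 1)) * (e - sact d) - (r ) * e"
      unfolding expand using rels by algebra
  qed (simp_all add: r_def)
qed

lemma nsE_minus_shift: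
  "nonsym_shift_op k (- 2, 1) (nsE_minus k) \<and> beta (Sym (nsE_minus k)) = (\<lambda>f. 2 * E_minus k f)"
proof -
  define c H where "c = (Z - 1) * inv_Zp1"
    and "H = cst (fst k) + cst (snd k) - cst (1 / 2)"
  define d e where "d = H + Z * inv_Zp1 ^ 2" and "e = - (Z * inv_Zp1 ^ 2)"
  define r where "r = cst (rho k)"
  note expand = c_def d_def e_def H_def refl_coeff_expand fst_add snd_add fst_conv snd_conv
    cst_add cst_uminus cst_0 cst_1 cst_numeral theta_rules sact_rules
  note rels = ratfun_rels two_half cst_rho[of k, folded r_def]
  have de: "d + e = H" by (simp add: d_def e_def H_def)
  show ?thesis
  proof (rule fundamental_shiftI[where c = c and d = d and e = e and h = H and r = r])
    fix f
    have frac: "(1 - inverse Z) / (1 + inverse Z) = c"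
      unfolding divide_inverse inv_coeffs(1,2)[unfolded divide_inverse mult_1] c_def
      using ratfun_rels by algebra
    show "E_minus k f = c * theta f + H * f"
      unfolding E_minus_def frac H_def by (simp add: cst_add cst_diff)
    moreover have "(f - sact f) / (Z - inverse Z) = (f - sact f) * (Z * inv_Zm1 * inv_Zp1)"
      unfolding inv_coeffs(3)[symmetric] by simp
    ultimately show "nsE_minus k f = c * theta f + d * f + e * sact f"
      unfolding nsE_minus_def frac unfolding c_def d_def e_def using ratfun_rels by algebra
  next
    show "c \<in> Laurent_Delta" "d \<in> Laurent_Delta" "e \<in> Laurent_Delta"
      unfolding c_def d_def e_def H_def by (intro Laurent_Delta_closed; simp)+
  next
    show "d + e \<in> Laurent" by (simp add: de H_def Laurent_closed)
    have "c * Z + d * Z + e * inverse Z = Z - 1 + H * Z"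
        "c * Delta = (Z - 1) ^ 2 * inverse Z"
      unfolding c_def d_def e_def Delta_def using ratfun_rels by (algebra, algebra)
    thus "c * Z + d * Z + e * inverse Z \<in> Laurent" "c * Delta \<in> Laurent"
      by (simp_all add: H_def Laurent_closed)
  next
    show "r  = cst (rho (k + (- 2, 1)))"
      unfolding r_def rho_shift by (simp add: cst_uminus)
  next
    show "sact c = - c"
      unfolding expand using rels by algebra
    show "d + e + sact (d + e) = 2 * H"
      unfolding de by (simp add: H_def sact_rules)
    show "2 * e = c * (refl_coeff (k + (- 2, 1)) - refl_coeff k)"
      unfolding expand using rels by algebra
    show "theta c = c * (refl_coeff k - refl_coeff (k + (- 2, 1)) + (r ) - r)"
      unfolding expand using rels by algebra
    show "c * theta (refl_coeff k) + d * (refl_coeff k - r) - e * (2 * r - refl_coeff k)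
        = theta d + refl_coeff (k + (- 2, 1)) * (d - sact e) - (r ) * d"
      unfolding expand using rels by algebra
    show "- (c * theta (refl_coeff k)) - d * refl_coeff k + e * (r - refl_coeff k)
        = theta e + refl_coeff (k + (- 2, 1)) * (e - sact d) - (r ) * e"
      unfolding expand using rels by algebra
  qed (simp_all add: r_def)
qed

theorem mainTheorem9:
  fixes k :: root_mult
  shows "(\<forall>l\<in>shift_lattice. \<forall>S. nonsym_shift_op k l S \<longrightarrow>
            Sym S \<circ> (Dop k \<circ> Dop k) = (Dop (k + l) \<circ> Dop (k + l)) \<circ> Sym S
          \<and> Sym S \<in> diffrefl_ops \<and> Sym S ` Cx \<subseteq> Cx
          \<and> beta (Sym S) \<circ> MLop k = MLop (k + l) \<circ> beta (Sym S)
          \<and> sym_shift_op k l (beta (Sym S)))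
       \<and> (nonsym_shift_op k (0, 1) (nsG_plus k)
          \<and> sym_shift_op k (0, 1) (beta (Sym (nsG_plus k)))
          \<and> beta (Sym (nsG_plus k)) = (\<lambda>f. 2 * G_plus k f))
       \<and> (nonsym_shift_op k (0, -1) (nsG_minus k)
          \<and> sym_shift_op k (0, -1) (beta (Sym (nsG_minus k)))
          \<and> beta (Sym (nsG_minus k)) = (\<lambda>f. 2 * G_minus k f))
       \<and> (nonsym_shift_op k (2, -1) (nsE_plus k)
          \<and> sym_shift_op k (2, -1) (beta (Sym (nsE_plus k)))
          \<and> beta (Sym (nsE_plus k)) = (\<lambda>f. 2 * E_plus k f))
       \<and> (nonsym_shift_op k (-2, 1) (nsE_minus k)
          \<and> sym_shift_op k (-2, 1) (beta (Sym (nsE_minus k)))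
          \<and> beta (Sym (nsE_minus k)) = (\<lambda>f. 2 * E_minus k f))"
proof (intro conjI ballI allI impI)
  fix l S
  assume S: "nonsym_shift_op k l S"
  note Sym = Sym_nonsym_shift_op[OF S]
  show "Sym S \<circ> (Dop k \<circ> Dop k) = (Dop (k + l) \<circ> Dop (k + l)) \<circ> Sym S"
    "Sym S \<in> diffrefl_ops" "Sym S ` Cx \<subseteq> Cx"
    "beta (Sym S) \<circ> MLop k = MLop (k + l) \<circ> beta (Sym S)"
    "sym_shift_op k l (beta (Sym S))"
    by (fact Sym)+
qed (use nsG_plus_shift nsG_minus_shift nsE_plus_shift nsE_minus_shift Sym_nonsym_shift_op(5)
    in blast)+

end
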